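(* Let $n\ge 2$ and $m\ge 1$ be integers. Suppose that for every family $B_1,\ldots,B_m$ of symmetric real $(n\times n)$-matrices with trace zero the inequality $$\sum_{\alpha,\beta=1}^m\|[B_{\alpha},B_{\beta}]\|^2\leq\left(\sum_{\alpha=1}^m\|B_{\alpha}\|^2\right)^2$$ holds. Then for every $c\in\mathbb{R}$ and every $n$-dimensional submanifold $M^n$ of a real space form $\widetilde{M}^{n+m}(c)$ of constant sectional curvature $c$, $$\rho \leq \|H\|^2-\rho^{\perp}+c$$ at every point of $M^n$.
   Context: For real $(n\times n)$-matrices, $\langle A,B\rangle=\mathrm{tr}(A^tB)$, $\|A\|^2=\mathrm{tr}(A^tA)=\sum_{i,j}(A_{ij})^2$, and $[A,B]=AB-BA$. For an $n$-dimensional Riemannian manifold $M^n$ isometrically immersed in a Riemannian manifold $\widetilde{M}^{n+m}$, let $R$ be the Riemann curvature tensor of $M^n$ (with the sign convention that $\langle R(X,Y)Y,X\rangle$ is the sectional curvature for orthonormal $X,Y$), $h$ the second fundamental form, and $R^{\perp}$ the curvature tensor of the normal connection. Let $p\in M^n$, let $\{e_1,\ldots,e_n\}$ be an orthonormal basis of $T_pM$ and $\{u_1,\ldots,u_m\}$ an orthonormal basis of the normal space $T_p^{\perp}M$. Define at $p$: - the normalized scalar curvature $\rho=\frac{2}{n(n-1)}\sum_{1\le i<j\le n}\langle R(e_i,e_j)e_j,e_i\rangle$; - the normalized normal scalar curvature $\rho^{\perp}=\frac{2}{n(n-1)}\sqrt{\sum_{1\le i<j\le n}\sum_{1\le\alpha<\beta\le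 m}\langle R^{\perp}(e_i,e_j)u_{\alpha},u_{\beta}\rangle^2}$; - the mean curvature vector $H=\frac1n\sum_{i=1}^n h(e_i,e_i)$. *)

theory Defs
  imports "HOL-Analysis.Analysis"
begin

abbreviation dirderiv ::
  "('a::real_normed_vector \<Rightarrow> 'b::real_normed_vector) \<Rightarrow> 'a \<Rightarrow> 'a \<Rightarrow> 'b" where
  "dirderiv f x v \<equiv> frechet_derivative f (at x) v"

text \<open>The set \<open>S\<close> is always an open set below.\<close>

primrec Ck_on ::
  "nat \<Rightarrow> 'a::euclidean_space set \<Rightarrow> ('a \<Rightarrow> 'b::real_normed_vector) \<Rightarrow> bool" where
  "Ck_on 0 S f \<longleftrightarrow> continuous_on S f"
| "Ck_on (Suc k) S f \<longleftrightarrow>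
     (\<forall>x\<in>S. f differentiable (at x)) \<and> (\<forall>v. Ck_on k S (\<lambda>x. dirderiv f x v))"

definition smooth_on ::
  "'a::euclidean_space set \<Rightarrow> ('a \<Rightarrow> 'b::real_normed_vector) \<Rightarrow> bool" where
  "smooth_on S f \<longleftrightarrow> (\<forall>k. Ck_on k S f)"

text \<open>A chart is a pair of its domain and its coordinate map; the values of the coordinate map
  outside the domain are irrelevant.\<close>

type_synonym ('p, 'e) chart = "'p set \<times> ('p \<Rightarrow> 'e)"

definition chart_inv :: "('p, 'e) chart \<Rightarrow> 'e \<Rightarrow> 'p" where
  "chart_inv \<phi> = inv_into (fst \<phi>) (snd \<phi>)"

text \<open>The atlas need not be maximal. The dimension of the manifold is \<open>DIM('e)\<close>.\<close>

definition smooth_manifold ::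
  "'p topology \<Rightarrow> ('p, 'e::euclidean_space) chart set \<Rightarrow> bool" where
  "smooth_manifold M A \<longleftrightarrow>
     Hausdorff_space M \<and> second_countable M \<and>
     (\<Union>\<phi>\<in>A. fst \<phi>) = topspace M \<and>
     (\<forall>\<phi>\<in>A. openin M (fst \<phi>) \<and> open (snd \<phi> ` fst \<phi>) \<and>
        homeomorphic_map (subtopology M (fst \<phi>)) (top_of_set (snd \<phi> ` fst \<phi>)) (snd \<phi>)) \<and>
     (\<forall>\<phi>\<in>A. \<forall>\<psi>\<in>A. smooth_on (snd \<phi> ` (fst \<phi> \<inter> fst \<psi>)) (snd \<psi> \<circ> chart_inv \<phi>))"

text \<open>A metric on a coordinate domain assigns to each point \<open>x\<close> a bilinear form on the model
  space, which is the tangent space at \<open>x\<close> in coordinates. A metric on a manifold is given by its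
  expressions in all charts of the atlas, subject to the transformation law.\<close>

type_synonym 'e coord_metric = "'e \<Rightarrow> 'e \<Rightarrow> 'e \<Rightarrow> real"

definition riemannian_manifold ::
  "'p topology \<Rightarrow> ('p, 'e::euclidean_space) chart set \<Rightarrow>
    (('p, 'e) chart \<Rightarrow> 'e coord_metric) \<Rightarrow> bool" where
  "riemannian_manifold M A g \<longleftrightarrow>
     smooth_manifold M A \<and>
     (\<forall>\<phi>\<in>A. \<forall>v w. smooth_on (snd \<phi> ` fst \<phi>) (\<lambda>x. g \<phi> x v w)) \<and>
     (\<forall>\<phi>\<in>A. \<forall>x\<in>snd \<phi> ` fst \<phi>.
        bilinear (g \<phi> x) \<and> (\<forall>v w. g \<phi> x v w = g \<phi> x w v) \<and> (\<forall>v. v \<noteq> 0 \<longrightarrow> g \<phi> x v v > 0)) \<and>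
     (\<forall>\<phi>\<in>A. \<forall>\<psi>\<in>A. \<forall>x\<in>snd \<phi> ` (fst \<phi> \<inter> fst \<psi>). \<forall>v w.
        g \<phi> x v w =
          (let \<tau> = snd \<psi> \<circ> chart_inv \<phi> in g \<psi> (\<tau> x) (dirderiv \<tau> x v) (dirderiv \<tau> x w)))"

text \<open>\<open>christoffel g x v w\<close> is the vector with components \<open>\<Gamma>\<^sup>k\<^sub>i\<^sub>j v\<^sup>i w\<^sup>j\<close>. It is determined by the
  Koszul formula for the coordinate-constant vector fields \<open>v\<close>, \<open>w\<close>, \<open>z\<close>, whose brackets vanish.\<close>

definition christoffel :: "'e::euclidean_space coord_metric \<Rightarrow> 'e \<Rightarrow> 'e \<Rightarrow> 'e \<Rightarrow> 'e" where
  "christoffel g x v w = (THE y. \<forall>z. 2 * g x y z =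
     dirderiv (\<lambda>q. g q w z) x v + dirderiv (\<lambda>q. g q v z) x w - dirderiv (\<lambda>q. g q v w) x z)"

definition covariant_deriv ::
  "'e::euclidean_space coord_metric \<Rightarrow> ('e \<Rightarrow> 'e) \<Rightarrow> ('e \<Rightarrow> 'e) \<Rightarrow> 'e \<Rightarrow> 'e" where
  "covariant_deriv g X Y x = dirderiv Y x (X x) + christoffel g x (X x) (Y x)"

definition lie_bracket ::
  "('e::euclidean_space \<Rightarrow> 'e) \<Rightarrow> ('e \<Rightarrow> 'e) \<Rightarrow> 'e \<Rightarrow> 'e" where
  "lie_bracket X Y x = dirderiv Y x (X x) - dirderiv X x (Y x)"

definition curvature_fields ::
  "'e::euclidean_space coord_metric \<Rightarrow> ('e \<Rightarrow> 'e) \<Rightarrow> ('e \<Rightarrow> 'e) \<Rightarrow> ('e \<Rightarrow> 'e) \<Rightarrow> 'e \<Rightarrow> 'e" where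
  "curvature_fields g X Y Z x =
     covariant_deriv g X (covariant_deriv g Y Z) x
     - covariant_deriv g Y (covariant_deriv g X Z) x
     - covariant_deriv g (lie_bracket X Y) Z x"

text \<open>\<open>R(v,w)z\<close> for tangent vectors at \<open>x\<close>. Since \<open>R\<close> is a tensor, any extensions to vector fields
  may be used; the coordinate-constant ones are taken.\<close>

definition curvature ::
  "'e::euclidean_space coord_metric \<Rightarrow> 'e \<Rightarrow> 'e \<Rightarrow> 'e \<Rightarrow> 'e \<Rightarrow> 'e" where
  "curvature g x v w z = curvature_fields g (\<lambda>_. v) (\<lambda>_. w) (\<lambda>_. z) x"

definition real_space_form ::
  "'p topology \<Rightarrow> ('p, 'e::euclidean_space) chart set \<Rightarrow>
    (('p, 'e) chart \<Rightarrow> 'e coord_metric) \<Rightarrow> real \<Rightarrow> bool" where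
  "real_space_form M A g c \<longleftrightarrow>
     riemannian_manifold M A g \<and>
     (\<forall>\<phi>\<in>A. \<forall>x\<in>snd \<phi> ` fst \<phi>. \<forall>v w.
        g \<phi> x v v = 1 \<and> g \<phi> x w w = 1 \<and> g \<phi> x v w = 0 \<longrightarrow>
        g \<phi> x (curvature (g \<phi>) x v w w) v = c)"

definition local_rep ::
  "('p, 'e) chart \<Rightarrow> ('q, 'f) chart \<Rightarrow> ('p \<Rightarrow> 'q) \<Rightarrow> 'e \<Rightarrow> 'f" where
  "local_rep \<phi> \<psi> f = snd \<psi> \<circ> f \<circ> chart_inv \<phi>"

text \<open>That the differentials are injective follows from the preservation of the metric.\<close>

definition isometric_immersion ::
  "'p topology \<Rightarrow> ('p, 'e::euclidean_space) chart set \<Rightarrow> (('p, 'e) chart \<Rightarrow> 'e coord_metric) \<Rightarrow>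
   'q topology \<Rightarrow> ('q, 'f::euclidean_space) chart set \<Rightarrow> (('q, 'f) chart \<Rightarrow> 'f coord_metric) \<Rightarrow>
   ('p \<Rightarrow> 'q) \<Rightarrow> bool" where
  "isometric_immersion M A g N A' g' f \<longleftrightarrow>
     continuous_map M N f \<and>
     (\<forall>\<phi>\<in>A. \<forall>\<psi>\<in>A'. let D = snd \<phi> ` (fst \<phi> \<inter> f -` fst \<psi>); F = local_rep \<phi> \<psi> f in
        smooth_on D F \<and>
        (\<forall>x\<in>D. \<forall>v w. g' \<psi> (F x) (dirderiv F x v) (dirderiv F x w) = g \<phi> x v w))"

text \<open>From here on \<open>F\<close> is the coordinate expression of an isometric immersion, \<open>g'\<close> is the ambient
  metric in the chart of the target, and \<open>X\<close> and \<open>\<xi>\<close> are a tangent vector field of the source and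
  an ambient vector field along \<open>F\<close>, all in coordinates.\<close>

definition normal_space_at ::
  "'f coord_metric \<Rightarrow> ('e::euclidean_space \<Rightarrow> 'f::euclidean_space) \<Rightarrow> 'e \<Rightarrow> 'f set" where
  "normal_space_at g' F x = {\<eta>. \<forall>v. g' (F x) (dirderiv F x v) \<eta> = 0}"

definition normal_part ::
  "'f coord_metric \<Rightarrow> ('e::euclidean_space \<Rightarrow> 'f::euclidean_space) \<Rightarrow> 'e \<Rightarrow> 'f \<Rightarrow> 'f" where
  "normal_part g' F x \<xi> =
     (THE \<eta>. \<eta> \<in> normal_space_at g' F x \<and> \<xi> - \<eta> \<in> range (\<lambda>v. dirderiv F x v))"

definition covariant_deriv_along ::
  "'f coord_metric \<Rightarrow> ('e::euclidean_space \<Rightarrow> 'f::euclidean_space) \<Rightarrow>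
    ('e \<Rightarrow> 'e) \<Rightarrow> ('e \<Rightarrow> 'f) \<Rightarrow> 'e \<Rightarrow> 'f" where
  "covariant_deriv_along g' F X \<xi> x =
     dirderiv \<xi> x (X x) + christoffel g' (F x) (dirderiv F x (X x)) (\<xi> x)"

text \<open>The normal part of the ambient covariant derivative of \<open>dF(Y)\<close> in direction \<open>v\<close>, where \<open>Y\<close>
  is the coordinate-constant extension of \<open>w\<close>; the choice of the extension is immaterial.\<close>

definition second_fundamental_form ::
  "'f coord_metric \<Rightarrow> ('e::euclidean_space \<Rightarrow> 'f::euclidean_space) \<Rightarrow> 'e \<Rightarrow> 'e \<Rightarrow> 'e \<Rightarrow> 'f" where
  "second_fundamental_form g' F x v w =
     normal_part g' F x (covariant_deriv_along g' F (\<lambda>_. v) (\<lambda>q. dirderiv F q w) x)"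

definition normal_connection ::
  "'f coord_metric \<Rightarrow> ('e::euclidean_space \<Rightarrow> 'f::euclidean_space) \<Rightarrow>
    ('e \<Rightarrow> 'e) \<Rightarrow> ('e \<Rightarrow> 'f) \<Rightarrow> 'e \<Rightarrow> 'f" where
  "normal_connection g' F X \<xi> x = normal_part g' F x (covariant_deriv_along g' F X \<xi> x)"

definition normal_curvature_fields ::
  "'f coord_metric \<Rightarrow> ('e::euclidean_space \<Rightarrow> 'f::euclidean_space) \<Rightarrow>
    ('e \<Rightarrow> 'e) \<Rightarrow> ('e \<Rightarrow> 'e) \<Rightarrow> ('e \<Rightarrow> 'f) \<Rightarrow> 'e \<Rightarrow> 'f" where
  "normal_curvature_fields g' F X Y \<xi> x =
     normal_connection g' F X (normal_connection g' F Y \<xi>) x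
     - normal_connection g' F Y (normal_connection g' F X \<xi>) x
     - normal_connection g' F (lie_bracket X Y) \<xi> x"

text \<open>The tangent vectors \<open>v\<close>, \<open>w\<close> are extended as coordinate-constant fields, and the normal vector
  \<open>u\<close> is extended to a normal field by projecting the coordinate-constant field \<open>u\<close>.\<close>

definition normal_curvature ::
  "'f coord_metric \<Rightarrow> ('e::euclidean_space \<Rightarrow> 'f::euclidean_space) \<Rightarrow>
    'e \<Rightarrow> 'e \<Rightarrow> 'e \<Rightarrow> 'f \<Rightarrow> 'f" where
  "normal_curvature g' F x v w u =
     normal_curvature_fields g' F (\<lambda>_. v) (\<lambda>_. w) (\<lambda>q. normal_part g' F q u) x"

definition orthonormal_basis ::
  "('v::real_vector \<Rightarrow> 'v \<Rightarrow> real) \<Rightarrow> 'v set \<Rightarrow> nat \<Rightarrow> (nat \<Rightarrow> 'v) \<Rightarrow> bool" where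
  "orthonormal_basis G V k b \<longleftrightarrow>
     (\<forall>i\<in>{1..k}. \<forall>j\<in>{1..k}. G (b i) (b j) = (if i = j then 1 else 0)) \<and>
     span (b ` {1..k}) = V"

definition normalized_scalar_curvature ::
  "'e::euclidean_space coord_metric \<Rightarrow> 'e \<Rightarrow> nat \<Rightarrow> (nat \<Rightarrow> 'e) \<Rightarrow> real" where
  "normalized_scalar_curvature g x n e =
     2 / (real n * (real n - 1)) *
     (\<Sum>j=1..n. \<Sum>i=1..<j. g x (curvature g x (e i) (e j) (e j)) (e i))"

definition normalized_normal_scalar_curvature ::
  "'f coord_metric \<Rightarrow> ('e::euclidean_space \<Rightarrow> 'f::euclidean_space) \<Rightarrow> 'e \<Rightarrow>
    nat \<Rightarrow> nat \<Rightarrow> (nat \<Rightarrow> 'e) \<Rightarrow> (nat \<Rightarrow> 'f) \<Rightarrow> real" where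
  "normalized_normal_scalar_curvature g' F x n m e u =
     2 / (real n * (real n - 1)) *
     sqrt (\<Sum>j=1..n. \<Sum>i=1..<j. \<Sum>\<beta>=1..m. \<Sum>\<alpha>=1..<\<beta>.
       (g' (F x) (normal_curvature g' F x (e i) (e j) (u \<alpha>)) (u \<beta>))\<^sup>2)"

definition mean_curvature_vector ::
  "'f coord_metric \<Rightarrow> ('e::euclidean_space \<Rightarrow> 'f::euclidean_space) \<Rightarrow> 'e \<Rightarrow>
    nat \<Rightarrow> (nat \<Rightarrow> 'e) \<Rightarrow> 'f" where
  "mean_curvature_vector g' F x n e =
     (1 / real n) *\<^sub>R (\<Sum>i=1..n. second_fundamental_form g' F x (e i) (e i))"

definition mat_normsq :: "real^'n^'n \<Rightarrow> real" where
  "mat_normsq A = trace (transpose A ** A)"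

definition commutator :: "real^'n^'n \<Rightarrow> real^'n^'n \<Rightarrow> real^'n^'n" where
  "commutator A B = A ** B - B ** A"

end

theory Submission
  imports Defs
begin

text \<open>In the pulled-back tangent bundle the ambient covariant derivative \<open>D\<close> along the immersion is
  metric and torsion-free, and its commutator is the ambient curvature. Comparing \<open>D\<close> with its
  tangential and normal parts gives the Gauss and Ricci equations; constant sectional curvature
  determines the ambient curvature terms. With
  \<open>a \<alpha> i j = \<langle>h(e\<^sub>i,e\<^sub>j),u\<^sub>\<alpha>\<rangle>\<close> and \<open>B\<^sub>\<alpha>\<close> the traceless part of \<open>a \<alpha>\<close>, the Gauss equation becomes
  \<open>\<rho> = c + \<parallel>H\<parallel>\<^sup>2 - (\<Sum>\<alpha>. \<parallel>B\<^sub>\<alpha>\<parallel>\<^sup>2) / (n (n - 1))\<close>, and the Ricci equation says that \<open>n (n - 1) \<rho>\<^sup>\<bottom>\<close> is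
  the square root of the sum of all \<open>\<parallel>[B\<^sub>\<alpha>,B\<^sub>\<beta>]\<parallel>\<^sup>2\<close>, so the matrix inequality is exactly what is needed.\<close>

section \<open>Smooth maps on open sets\<close>

text \<open>Christoffel vectors and normal parts are defined by \<open>THE\<close>, whereas product
  rules, commuting derivatives and curvature itself need fields that are differentiable near a
  point. Cramer's rule answers both concerns at once: the vector representing a linear form with
  respect to a metric is a quotient of determinants, so it exists, is unique and depends smoothly on
  the point. Christoffel vectors and tangential parts have this shape, and normal parts follow by
  subtraction. The Gauss and Ricci equations are proved for arbitrary vectors; bases enter only
  afterwards and only at the given point, so no orthonormal frame has to be extended to a
  neighbourhood.\<close>

lemma Ck_on_cong:
  fixes f g :: "'a::euclidean_space \<Rightarrow> 'b::real_normed_vector"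
  assumes "open S" "\<And>x. x \<in> S \<Longrightarrow> f x = g x"
  shows "Ck_on k S f \<longleftrightarrow> Ck_on k S g"
  using assms(2)
proof (induction k arbitrary: f g)
  case 0
  then show ?case by (auto intro: continuous_on_cong)
next
  case (Suc k)
  have imp: "Ck_on (Suc k) S g" if C: "Ck_on (Suc k) S f" and eq: "\<And>x. x \<in> S \<Longrightarrow> f x = g x"
    for f g :: "'a \<Rightarrow> 'b"
  proof -
    have g: "g differentiable (at x)" "frechet_derivative f (at x) = frechet_derivative g (at x)"
      if "x \<in> S" for x
    proof -
      have "f differentiable (at x)"
        using C that by simp
      then show "g differentiable (at x)"
        by (metis Derivative.differentiableI assms(1) eq frechet_derivative_works
            has_derivative_transform_within_open that)
      show "frechet_derivative f (at x) = frechet_derivative g (at x)"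
        using \<open>f differentiable (at x)\<close> assms(1) that eq
        by (rule frechet_derivative_transform_within_open)
    qed
    then show ?thesis
      using C Suc.IH[of "\<lambda>x. dirderiv f x v" "\<lambda>x. dirderiv g x v" for v] by auto
  qed
  show ?case
    using imp[of f g] imp[of g f] Suc.prems by metis
qed

text \<open>Lets the closure proofs below work with the closed formula \<open>f'\<close> that a rule
  of calculus supplies, in place of the opaque \<open>dirderiv\<close>.\<close>

lemma Ck_on_SucI:
  assumes "open S" "\<And>x. x \<in> S \<Longrightarrow> (f has_derivative f' x) (at x)"
    and "\<And>v. Ck_on k S (\<lambda>x. f' x v)"
  shows "Ck_on (Suc k) S f"
proof -
  have "f' x = frechet_derivative f (at x)" if "x \<in> S" for x
    by (simp add: assms(2) frechet_derivative_at that)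
  then have "Ck_on k S (\<lambda>x. dirderiv f x v)" for v
    using assms(3)[of v] Ck_on_cong[OF assms(1), of "\<lambda>x. f' x v" "\<lambda>x. dirderiv f x v"] by simp
  then show ?thesis
    using assms(2) by (auto simp: differentiable_def)
qed

lemma Ck_on_SucD:
  assumes "Ck_on (Suc k) S f" "x \<in> S"
  shows "(f has_derivative (\<lambda>v. dirderiv f x v)) (at x)"
  using assms by (simp add: frechet_derivative_works[symmetric])

lemma Ck_on_Suc_imp_Ck_on: "Ck_on (Suc k) S f \<Longrightarrow> Ck_on k S f"
proof (induction k arbitrary: f)
  case 0
  then show ?case
    by (auto intro!: continuous_at_imp_continuous_on differentiable_imp_continuous_within)
next
  case (Suc k)
  then show ?case by (metis Ck_on.simps(2))
qed

lemma Ck_on_const: "open S \<Longrightarrow> Ck_on k S (\<lambda>x. c)"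
  by (induction k arbitrary: c) auto

lemma Ck_on_bounded_linear:
  assumes "open S" "bounded_linear L" "Ck_on k S f"
  shows "Ck_on k S (\<lambda>x. L (f x))"
  using assms(3)
proof (induction k arbitrary: f)
  case 0
  then show ?case
    by (simp add: assms(2) bounded_linear.continuous_on)
next
  case (Suc k)
  show ?case
  proof (rule Ck_on_SucI[OF assms(1)])
    show "((\<lambda>x. L (f x)) has_derivative (\<lambda>v. L (dirderiv f x v))) (at x)" if "x \<in> S" for x
      using bounded_linear.has_derivative[OF assms(2) Ck_on_SucD[OF Suc.prems that]] .
    show "Ck_on k S (\<lambda>x. L (dirderiv f x v))" for v
      using Suc by simp
  qed
qed

lemma Ck_on_ident: "open S \<Longrightarrow> Ck_on k S (\<lambda>x. x)"
  by (induction k) (auto simp: Ck_on_const)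

lemma Ck_on_add:
  assumes "open S" "Ck_on k S f" "Ck_on k S g"
  shows "Ck_on k S (\<lambda>x. f x + g x)"
  using assms(2,3)
proof (induction k arbitrary: f g)
  case 0
  then show ?case by (simp add: continuous_on_add)
next
  case (Suc k)
  show ?case
  proof (rule Ck_on_SucI[OF assms(1)])
    show "((\<lambda>x. f x + g x) has_derivative (\<lambda>v. dirderiv f x v + dirderiv g x v)) (at x)"
      if "x \<in> S" for x
      using that Suc.prems by (intro has_derivative_add Ck_on_SucD)
    show "Ck_on k S (\<lambda>x. dirderiv f x v + dirderiv g x v)" for v
      using Suc by simp
  qed
qed

lemma Ck_on_bounded_bilinear:
  assumes "open S" "bounded_bilinear B" "Ck_on k S f" "Ck_on k S g"
  shows "Ck_on k S (\<lambda>x. B (f x) (g x))"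
  using assms(3,4)
proof (induction k arbitrary: f g)
  case 0
  then show ?case
    by (simp add: assms(2) bounded_bilinear.continuous_on)
next
  case (Suc k)
  show ?case
  proof (rule Ck_on_SucI[OF assms(1)])
    show "((\<lambda>x. B (f x) (g x)) has_derivative
        (\<lambda>v. B (f x) (dirderiv g x v) + B (dirderiv f x v) (g x))) (at x)" if "x \<in> S" for x
      using that Suc.prems by (intro bounded_bilinear.FDERIV[OF assms(2)] Ck_on_SucD)
    show "Ck_on k S (\<lambda>x. B (f x) (dirderiv g x v) + B (dirderiv f x v) (g x))" for v
      by (intro Ck_on_add[OF assms(1)] Suc.IH Ck_on_Suc_imp_Ck_on[OF Suc.prems(1)]
          Ck_on_Suc_imp_Ck_on[OF Suc.prems(2)]) (use Suc.prems in auto)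
  qed
qed

text \<open>The derivative of the reciprocal contains the same reciprocal again, one order of
  differentiability lower, so the induction keeps \<open>f\<close> fixed.\<close>

lemma Ck_on_inverse:
  fixes f :: "'a::euclidean_space \<Rightarrow> real"
  assumes "open S" "Ck_on k S f" "\<And>x. x \<in> S \<Longrightarrow> f x \<noteq> 0"
  shows "Ck_on k S (\<lambda>x. inverse (f x))"
  using assms(2)
proof (induction k)
  case 0
  then show ?case
    by (simp add: assms(3) continuous_on_inverse)
next
  case (Suc k)
  have bm: "bounded_bilinear ((*) :: real \<Rightarrow> real \<Rightarrow> real)"
    by (rule bounded_bilinear_mult)
  show ?case
  proof (rule Ck_on_SucI[OF assms(1)])
    show "((\<lambda>x. inverse (f x)) has_derivative
        (\<lambda>v. - (inverse (f x) * dirderiv f x v * inverse (f x)))) (at x)" if "x \<in> S" for x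
      using that Suc.prems assms(3) by (intro Deriv.has_derivative_inverse Ck_on_SucD)
    have *: "Ck_on k S (\<lambda>x. inverse (f x))"
      using Suc Ck_on_Suc_imp_Ck_on by blast
    have "Ck_on k S (\<lambda>x. (inverse (f x) * dirderiv f x v * inverse (f x)))" for v
      using * Suc.prems by (intro Ck_on_bounded_bilinear[OF assms(1) bm]) auto
    then show "Ck_on k S (\<lambda>x. - (inverse (f x) * dirderiv f x v * inverse (f x)))" for v
      by (rule Ck_on_bounded_linear[OF assms(1) bounded_linear_minus[OF bounded_linear_ident]])
  qed
qed

lemma Ck_on_sum:
  assumes "open S" "\<And>i. i \<in> I \<Longrightarrow> Ck_on k S (f i)"
  shows "Ck_on k S (\<lambda>x. \<Sum>i\<in>I. f i x)"
  using assms(2)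
  by (induction I rule: infinite_finite_induct) (auto simp: Ck_on_const Ck_on_add assms(1))

lemma linear_eq_sum_Basis:
  assumes "linear L"
  shows "L v = (\<Sum>b\<in>Basis. (v \<bullet> b) *\<^sub>R L b)"
proof -
  have "L v = L (\<Sum>b\<in>Basis. (v \<bullet> b) *\<^sub>R b)"
    by (simp add: euclidean_representation)
  then show ?thesis
    by (simp add: assms linear_sum linear_scale)
qed

text \<open>The chain rule differentiates \<open>f\<close> at \<open>g x\<close> in the direction
  \<open>dirderiv g x v\<close>, which moves with \<open>x\<close>, while \<open>Ck_on\<close>
  speaks of fixed directions only. Expanding that direction in the basis repairs this. The induction
  hypothesis is then applied to directional derivatives of \<open>f\<close>, which is why
  \<open>f\<close> is generalised.\<close>

lemma Ck_on_compose:
  fixes g :: "'a::euclidean_space \<Rightarrow> 'b::euclidean_space"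
  assumes "open S" "open T" "Ck_on k S g" "g ` S \<subseteq> T" "Ck_on k T f"
  shows "Ck_on k S (\<lambda>x. f (g x))"
  using assms(3,5)
proof (induction k arbitrary: f)
  case 0
  then show ?case
    by (simp add: assms(4) continuous_on_compose2)
next
  case (Suc k)
  show ?case
  proof (rule Ck_on_SucI[OF assms(1)])
    fix x assume x: "x \<in> S"
    then have gx: "g x \<in> T"
      using assms(4) by auto
    have lin: "linear (\<lambda>v. dirderiv f (g x) v)"
      using Ck_on_SucD[OF Suc.prems(2) gx] has_derivative_linear by blast
    have "((\<lambda>x. f (g x)) has_derivative (\<lambda>v. dirderiv f (g x) (dirderiv g x v))) (at x)"
      using has_derivative_compose[OF Ck_on_SucD[OF Suc.prems(1) x] Ck_on_SucD[OF Suc.prems(2) gx]] .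
    then show "((\<lambda>x. f (g x)) has_derivative
        (\<lambda>v. \<Sum>b\<in>Basis. (dirderiv g x v \<bullet> b) *\<^sub>R dirderiv f (g x) b)) (at x)"
      by (subst (asm) linear_eq_sum_Basis[OF lin])
  next
    fix v
    have g: "Ck_on k S g"
      using Ck_on_Suc_imp_Ck_on Suc.prems(1) by blast
    show "Ck_on k S (\<lambda>x. \<Sum>b\<in>Basis. (dirderiv g x v \<bullet> b) *\<^sub>R dirderiv f (g x) b)"
      by (intro Ck_on_sum[OF assms(1)] Ck_on_bounded_bilinear[OF assms(1) bounded_bilinear_scaleR]
          Ck_on_bounded_linear[OF assms(1) bounded_linear_inner_left] Suc.IH g)
        (use Suc.prems in auto)
  qed
qed

section \<open>Closure properties of smooth maps and rules for directional derivatives\<close>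

named_theorems smooth_intros

lemma smooth_on_cong:
  assumes "open S" "\<And>x. x \<in> S \<Longrightarrow> f x = g x" "smooth_on S g"
  shows "smooth_on S f"
  using Ck_on_cong[OF assms(1), of f g] assms(2,3) by (simp add: smooth_on_def)

lemma smooth_on_const [smooth_intros]: "open S \<Longrightarrow> smooth_on S (\<lambda>x. c)"
  by (simp add: smooth_on_def Ck_on_const)

lemma smooth_on_ident [smooth_intros]: "open S \<Longrightarrow> smooth_on S (\<lambda>x. x)"
  by (simp add: smooth_on_def Ck_on_ident)

lemma smooth_on_add [smooth_intros]:
  "open S \<Longrightarrow> smooth_on S f \<Longrightarrow> smooth_on S g \<Longrightarrow> smooth_on S (\<lambda>x. f x + g x)"
  by (simp add: smooth_on_def Ck_on_add)

lemma smooth_on_sum [smooth_intros]: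
  "open S \<Longrightarrow> (\<And>i. i \<in> I \<Longrightarrow> smooth_on S (F i)) \<Longrightarrow> smooth_on S (\<lambda>x. \<Sum>i\<in>I. F i x)"
  by (simp add: smooth_on_def Ck_on_sum)

lemma smooth_on_scaleR [smooth_intros]:
  "open S \<Longrightarrow> smooth_on S r \<Longrightarrow> smooth_on S f \<Longrightarrow> smooth_on S (\<lambda>x. r x *\<^sub>R f x)"
  by (simp add: smooth_on_def Ck_on_bounded_bilinear[OF _ bounded_bilinear_scaleR])

lemma smooth_on_dirderiv: "smooth_on S f \<Longrightarrow> smooth_on S (\<lambda>x. dirderiv f x v)"
  by (metis Ck_on.simps(2) smooth_on_def)

lemma smooth_on_bounded_linear:
  "open S \<Longrightarrow> bounded_linear L \<Longrightarrow> smooth_on S f \<Longrightarrow> smooth_on S (\<lambda>x. L (f x))"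
  by (simp add: smooth_on_def Ck_on_bounded_linear)

lemma smooth_on_minus [smooth_intros]: "open S \<Longrightarrow> smooth_on S f \<Longrightarrow> smooth_on S (\<lambda>x. - f x)"
  by (rule smooth_on_bounded_linear[OF _ bounded_linear_minus[OF bounded_linear_ident]])

lemma smooth_on_diff [smooth_intros]:
  "open S \<Longrightarrow> smooth_on S f \<Longrightarrow> smooth_on S g \<Longrightarrow> smooth_on S (\<lambda>x. f x - g x)"
  using smooth_on_add[of S f "\<lambda>x. - g x"] smooth_on_minus[of S g] by simp

lemma smooth_on_inner_left [smooth_intros]:
  "open S \<Longrightarrow> smooth_on S f \<Longrightarrow> smooth_on S (\<lambda>x. f x \<bullet> b)"
  by (rule smooth_on_bounded_linear[OF _ bounded_linear_inner_left])

lemma smooth_on_mult [smooth_intros]: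
  fixes r s :: "'a::euclidean_space \<Rightarrow> real"
  shows "open S \<Longrightarrow> smooth_on S r \<Longrightarrow> smooth_on S s \<Longrightarrow> smooth_on S (\<lambda>x. r x * s x)"
  using smooth_on_scaleR[of S r s] by simp

lemma smooth_on_inverse:
  fixes r :: "'a::euclidean_space \<Rightarrow> real"
  shows "open S \<Longrightarrow> smooth_on S r \<Longrightarrow> (\<And>x. x \<in> S \<Longrightarrow> r x \<noteq> 0) \<Longrightarrow> smooth_on S (\<lambda>x. inverse (r x))"
  unfolding smooth_on_def by (auto intro: Ck_on_inverse)

lemma smooth_on_prod [smooth_intros]:
  fixes r :: "'i \<Rightarrow> 'a::euclidean_space \<Rightarrow> real"
  assumes "open S" "\<And>i. i \<in> I \<Longrightarrow> smooth_on S (r i)"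
  shows "smooth_on S (\<lambda>x. \<Prod>i\<in>I. r i x)"
  using assms(2)
  by (induction I rule: infinite_finite_induct) (auto simp: smooth_on_const smooth_on_mult assms(1))

lemma smooth_on_compose:
  fixes g :: "'a::euclidean_space \<Rightarrow> 'b::euclidean_space"
  assumes "open S" "open T" "smooth_on S g" "g ` S \<subseteq> T" "smooth_on T f"
  shows "smooth_on S (\<lambda>x. f (g x))"
  using assms Ck_on_compose unfolding smooth_on_def by blast

lemma smooth_on_subset: "smooth_on T f \<Longrightarrow> S \<subseteq> T \<Longrightarrow> smooth_on S f"
proof -
  assume "S \<subseteq> T"
  then have "Ck_on k T f \<Longrightarrow> Ck_on k S f" for k
    by (induction k arbitrary: f) (auto intro: continuous_on_subset)
  then show "smooth_on T f \<Longrightarrow> smooth_on S f"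
    by (simp add: smooth_on_def)
qed

lemma smooth_on_has_derivative:
  assumes "smooth_on S f" "x \<in> S"
  shows "(f has_derivative (\<lambda>v. dirderiv f x v)) (at x)"
  using assms Ck_on_SucD unfolding smooth_on_def by blast

lemma smooth_on_differentiable: "smooth_on S f \<Longrightarrow> x \<in> S \<Longrightarrow> f differentiable (at x)"
  using smooth_on_has_derivative Derivative.differentiableI by blast

lemma linear_dirderiv: "smooth_on S f \<Longrightarrow> x \<in> S \<Longrightarrow> linear (\<lambda>v. dirderiv f x v)"
  using linear_frechet_derivative smooth_on_differentiable by blast

lemma dirderiv_eqI: "(f has_derivative f') (at x) \<Longrightarrow> dirderiv f x v = f' v"
  by (metis frechet_derivative_at)

lemma dirderiv_cong:
  assumes "open S" "x \<in> S" "smooth_on S f" "\<And>q. q \<in> S \<Longrightarrow> f q = h q"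
  shows "dirderiv f x v = dirderiv h x v"
  using frechet_derivative_transform_within_open[OF smooth_on_differentiable[OF assms(3,2)] assms(1,2,4)]
  by simp

lemma dirderiv_add:
  assumes "smooth_on S f" "smooth_on S h" "x \<in> S"
  shows "dirderiv (\<lambda>q. f q + h q) x v = dirderiv f x v + dirderiv h x v"
  by (intro dirderiv_eqI has_derivative_add smooth_on_has_derivative[OF _ assms(3)] assms)

lemma dirderiv_diff:
  assumes "smooth_on S f" "smooth_on S h" "x \<in> S"
  shows "dirderiv (\<lambda>q. f q - h q) x v = dirderiv f x v - dirderiv h x v"
  by (intro dirderiv_eqI has_derivative_diff smooth_on_has_derivative[OF _ assms(3)] assms)

lemma dirderiv_scaleR_const:
  assumes "smooth_on S f" "x \<in> S"
  shows "dirderiv (\<lambda>q. r *\<^sub>R f q) x v = r *\<^sub>R dirderiv f x v"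
  by (intro dirderiv_eqI has_derivative_scaleR_right smooth_on_has_derivative[OF _ assms(2)] assms)

section \<open>Symmetry of second derivatives\<close>

lemma second_difference_mean_value:
  fixes f :: "'a::euclidean_space \<Rightarrow> real"
  assumes f: "smooth_on S f" and h: "h > 0"
    and S: "\<And>s t. 0 \<le> s \<Longrightarrow> s \<le> h \<Longrightarrow> 0 \<le> t \<Longrightarrow> t \<le> h \<Longrightarrow> x + s *\<^sub>R v + t *\<^sub>R w \<in> S"
  shows "\<exists>s t. 0 < s \<and> s < h \<and> 0 < t \<and> t < h \<and>
    f (x + h *\<^sub>R v + h *\<^sub>R w) - f (x + h *\<^sub>R v) - f (x + h *\<^sub>R w) + f x
      = h * (h * dirderiv (\<lambda>q. dirderiv f q v) (x + s *\<^sub>R v + t *\<^sub>R w) w)"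
proof -
  have line: "DERIV (\<lambda>s. k (a + s *\<^sub>R b)) s :> dirderiv k (a + s *\<^sub>R b) b"
    if "smooth_on S k" "a + s *\<^sub>R b \<in> S" for k :: "'a \<Rightarrow> real" and a b s
  proof -
    have "((\<lambda>s. a + s *\<^sub>R b) has_derivative (\<lambda>r. r *\<^sub>R b)) (at s)"
      by (auto intro!: derivative_eq_intros)
    from has_derivative_compose[OF this smooth_on_has_derivative[OF that]]
    have "((\<lambda>s. k (a + s *\<^sub>R b)) has_derivative (\<lambda>r. dirderiv k (a + s *\<^sub>R b) (r *\<^sub>R b))) (at s)" .
    moreover have "(\<lambda>r. dirderiv k (a + s *\<^sub>R b) (r *\<^sub>R b)) = (*) (dirderiv k (a + s *\<^sub>R b) b)"
      using linear_dirderiv[OF that] by (auto simp: linear_scale)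
    ultimately show ?thesis
      by (simp add: has_field_derivative_def)
  qed
  \<comment> \<open>\<open>G s\<close> is the increment of \<open>f\<close> over the step
    \<open>h *\<^sub>R w\<close> from \<open>x + s *\<^sub>R v\<close>, so the second difference is
    \<open>G h - G 0\<close>. The mean value theorem for \<open>G\<close> leaves the increment
    \<open>K h - K 0\<close> of a first derivative, to which the theorem is applied once
    more.\<close>
  define G where "G = (\<lambda>s. f ((x + h *\<^sub>R w) + s *\<^sub>R v) - f (x + s *\<^sub>R v))"
  have "\<exists>z>0. z < h \<and> G h - G 0
      = (h - 0) * (dirderiv f ((x + h *\<^sub>R w) + z *\<^sub>R v) v - dirderiv f (x + z *\<^sub>R v) v)"
  proof (rule MVT2[OF h])
    fix s assume "0 \<le> s" "s \<le> h"
    then show "DERIV G s :> dirderiv f ((x + h *\<^sub>R w) + s *\<^sub>R v) v - dirderiv f (x + s *\<^sub>R v) v"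
      unfolding G_def using S[of s h] S[of s 0] h
      by (intro DERIV_diff line f) (simp_all add: add_ac)
  qed
  then obtain s where s: "0 < s" "s < h"
    "G h - G 0 = h * (dirderiv f (x + s *\<^sub>R v + h *\<^sub>R w) v - dirderiv f (x + s *\<^sub>R v) v)"
    by (auto simp: add_ac)
  define K where "K = (\<lambda>t. dirderiv f ((x + s *\<^sub>R v) + t *\<^sub>R w) v)"
  have "\<exists>z>0. z < h \<and> K h - K 0 =
      (h - 0) * dirderiv (\<lambda>q. dirderiv f q v) ((x + s *\<^sub>R v) + z *\<^sub>R w) w"
  proof (rule MVT2[OF h])
    fix t assume "0 \<le> t" "t \<le> h"
    then show "DERIV K t :> dirderiv (\<lambda>q. dirderiv f q v) ((x + s *\<^sub>R v) + t *\<^sub>R w) w"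
      unfolding K_def using S[of s t] s by (intro line smooth_on_dirderiv f) simp
  qed
  then obtain t where t: "0 < t" "t < h"
    "K h - K 0 = h * dirderiv (\<lambda>q. dirderiv f q v) (x + s *\<^sub>R v + t *\<^sub>R w) w"
    by auto
  have "G h - G 0 = h * (K h - K 0)"
    using s(3) by (simp add: K_def)
  then show ?thesis
    using s(1,2) t by (intro exI[of _ s] exI[of _ t]) (simp add: G_def algebra_simps)
qed

text \<open>The second difference is symmetric in \<open>v\<close> and \<open>w\<close>. So the two
  mixed derivatives take a common value at points as close to \<open>x\<close> as desired, and
  continuity, with half of the supposed gap as tolerance, excludes different values at
  \<open>x\<close>.\<close>

lemma dirderiv_commute_real:
  fixes f :: "'a::euclidean_space \<Rightarrow> real"
  assumes S: "open S" and x: "x \<in> S" and f: "smooth_on S f"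
  shows "dirderiv (\<lambda>q. dirderiv f q v) x w = dirderiv (\<lambda>q. dirderiv f q w) x v"
proof (rule ccontr)
  define P where "P = (\<lambda>q. dirderiv (\<lambda>q. dirderiv f q v) q w)"
  define Q where "Q = (\<lambda>q. dirderiv (\<lambda>q. dirderiv f q w) q v)"
  assume "dirderiv (\<lambda>q. dirderiv f q v) x w \<noteq> dirderiv (\<lambda>q. dirderiv f q w) x v"
  then have e: "\<bar>P x - Q x\<bar> / 2 > 0"
    by (simp add: P_def Q_def)
  have "smooth_on S P" "smooth_on S Q"
    unfolding P_def Q_def by (intro smooth_on_dirderiv f)+
  then have "isCont P x" "isCont Q x"
    using x smooth_on_differentiable differentiable_imp_continuous_within by blast+
  then obtain d1 d2 where d: "d1 > 0" "\<And>q. dist q x < d1 \<Longrightarrow> dist (P q) (P x) < \<bar>P x - Q x\<bar> / 2"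
    "d2 > 0" "\<And>q. dist q x < d2 \<Longrightarrow> dist (Q q) (Q x) < \<bar>P x - Q x\<bar> / 2"
    using e unfolding continuous_at_eps_delta by metis
  obtain d3 where d3: "d3 > 0" "ball x d3 \<subseteq> S"
    using S x open_contains_ball by metis
  define d where "d = min d1 (min d2 d3)"
  \<comment> \<open>The summand 1 keeps the denominator positive even for zero vectors and makes the
    distance bound below strict.\<close>
  define h where "h = d / (norm v + norm w + 1)"
  have nn: "norm v + norm w + 1 > 0"
    by (smt (verit) norm_ge_zero)
  have dpos: "d > 0"
    using d d3 by (simp add: d_def)
  have h: "h > 0"
    using nn dpos by (simp add: h_def)
  have near: "dist (x + s *\<^sub>R v + t *\<^sub>R w) x < d" if "0 \<le> s" "s \<le> h" "0 \<le> t" "t \<le> h" for s t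
  proof -
    have "dist (x + s *\<^sub>R v + t *\<^sub>R w) x = norm (s *\<^sub>R v + t *\<^sub>R w)"
      by (simp add: dist_norm add.assoc)
    also have "\<dots> \<le> norm (s *\<^sub>R v) + norm (t *\<^sub>R w)"
      by (rule norm_triangle_ineq)
    also have "\<dots> \<le> h * norm v + h * norm w"
      using that by (intro add_mono) (simp_all add: mult_right_mono)
    also have "\<dots> < h * (norm v + norm w + 1)"
      using h by (simp add: algebra_simps)
    also have "\<dots> = d"
      using nn by (simp add: h_def)
    finally show ?thesis .
  qed
  have inS: "x + s *\<^sub>R v + t *\<^sub>R w \<in> S" if "0 \<le> s" "s \<le> h" "0 \<le> t" "t \<le> h" for s t
    using near[OF that] d3 by (auto simp: d_def dist_commute)
  have inS': "x + s *\<^sub>R w + t *\<^sub>R v \<in> S" if "0 \<le> s" "s \<le> h" "0 \<le> t" "t \<le> h" for s t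
    using inS[of t s] that by (simp add: add_ac)
  obtain s t where st: "0 < s" "s < h" "0 < t" "t < h"
    "f (x + h *\<^sub>R v + h *\<^sub>R w) - f (x + h *\<^sub>R v) - f (x + h *\<^sub>R w) + f x
      = h * (h * P (x + s *\<^sub>R v + t *\<^sub>R w))"
    using second_difference_mean_value[OF f h inS] unfolding P_def by blast
  obtain s' t' where st': "0 < s'" "s' < h" "0 < t'" "t' < h"
    "f (x + h *\<^sub>R w + h *\<^sub>R v) - f (x + h *\<^sub>R w) - f (x + h *\<^sub>R v) + f x
      = h * (h * Q (x + s' *\<^sub>R w + t' *\<^sub>R v))"
    using second_difference_mean_value[OF f h inS'] unfolding Q_def by blast
  have "h * (h * P (x + s *\<^sub>R v + t *\<^sub>R w)) = h * (h * Q (x + t' *\<^sub>R v + s' *\<^sub>R w))"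
    using st(5) st'(5) by (simp only: add.assoc add.commute[of "_ *\<^sub>R w" "_ *\<^sub>R v"])
  then have "P (x + s *\<^sub>R v + t *\<^sub>R w) = Q (x + t' *\<^sub>R v + s' *\<^sub>R w)"
    using h by simp
  moreover have "dist (P (x + s *\<^sub>R v + t *\<^sub>R w)) (P x) < \<bar>P x - Q x\<bar> / 2"
    using near[of s t] st by (intro d) (simp add: d_def)
  moreover have "dist (Q (x + t' *\<^sub>R v + s' *\<^sub>R w)) (Q x) < \<bar>P x - Q x\<bar> / 2"
    using near[of t' s'] st' by (intro d) (simp add: d_def)
  ultimately show False
    unfolding dist_real_def by (smt (verit) field_sum_of_halves)
qed

lemma dirderiv_commute:
  fixes f :: "'a::euclidean_space \<Rightarrow> 'b::euclidean_space"
  assumes S: "open S" and x: "x \<in> S" and f: "smooth_on S f"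
  shows "dirderiv (\<lambda>q. dirderiv f q v) x w = dirderiv (\<lambda>q. dirderiv f q w) x v"
proof (rule euclidean_eqI)
  fix b :: 'b
  have inner: "dirderiv (\<lambda>q. k q \<bullet> b) q a = dirderiv k q a \<bullet> b"
    if "smooth_on S k" "q \<in> S" for k :: "'a \<Rightarrow> 'b" and q a
    by (rule dirderiv_eqI[OF has_derivative_inner_left[OF smooth_on_has_derivative[OF that]]])
  have second: "dirderiv (\<lambda>q. dirderiv f q v) x w \<bullet> b
      = dirderiv (\<lambda>q. dirderiv (\<lambda>q. f q \<bullet> b) q v) x w" for v w
  proof -
    have "dirderiv (\<lambda>q. dirderiv f q v) x w \<bullet> b = dirderiv (\<lambda>q. dirderiv f q v \<bullet> b) x w"
      using x by (simp add: inner smooth_on_dirderiv f)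
    also have "\<dots> = dirderiv (\<lambda>q. dirderiv (\<lambda>q. f q \<bullet> b) q v) x w"
      by (rule dirderiv_cong[OF S x])
        (auto simp: inner f intro!: smooth_on_inner_left smooth_on_dirderiv S f)
    finally show ?thesis .
  qed
  show "dirderiv (\<lambda>q. dirderiv f q v) x w \<bullet> b = dirderiv (\<lambda>q. dirderiv f q w) x v \<bullet> b"
    unfolding second by (rule dirderiv_commute_real[OF S x smooth_on_inner_left[OF S f]])
qed

section \<open>Bilinear maps that vary with the base point\<close>

lemma bilinear_sum_Basis:
  assumes "bilinear B"
  shows "B a b = (\<Sum>i\<in>Basis. \<Sum>j\<in>Basis. ((a \<bullet> i) * (b \<bullet> j)) *\<^sub>R B i j)"
proof -
  have "B a b = (\<Sum>i\<in>Basis. (a \<bullet> i) *\<^sub>R B i b)"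
    using assms linear_eq_sum_Basis[of "\<lambda>a. B a b" a] by (simp add: bilinear_def)
  also have "\<dots> = (\<Sum>i\<in>Basis. (a \<bullet> i) *\<^sub>R (\<Sum>j\<in>Basis. (b \<bullet> j) *\<^sub>R B i j))"
    using assms linear_eq_sum_Basis[of "\<lambda>b. B i b" b for i] by (simp add: bilinear_def)
  finally show ?thesis
    by (simp add: scaleR_sum_right)
qed

text \<open>Smoothness is assumed for constant arguments only; the double basis expansion carries it
  over to varying ones. Metrics, Christoffel vectors and the differential of a map are all handled
  through this lemma.\<close>

lemma smooth_on_bilinear_field:
  fixes B :: "'b::euclidean_space \<Rightarrow> 'c::euclidean_space \<Rightarrow> 'd::euclidean_space \<Rightarrow> 'e::real_normed_vector"
  assumes "open S" "open V" "\<And>y. y \<in> V \<Longrightarrow> bilinear (B y)"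
    and "\<And>a b. smooth_on V (\<lambda>y. B y a b)"
    and "smooth_on S F" "F ` S \<subseteq> V" "smooth_on S \<xi>" "smooth_on S \<eta>"
  shows "smooth_on S (\<lambda>q. B (F q) (\<xi> q) (\<eta> q))"
proof (rule smooth_on_cong[OF assms(1)])
  show "B (F q) (\<xi> q) (\<eta> q)
      = (\<Sum>i\<in>Basis. \<Sum>j\<in>Basis. ((\<xi> q \<bullet> i) * (\<eta> q \<bullet> j)) *\<^sub>R B (F q) i j)" if "q \<in> S" for q
    using that assms(3,6) by (intro bilinear_sum_Basis) auto
  show "smooth_on S (\<lambda>q. \<Sum>i\<in>Basis. \<Sum>j\<in>Basis. ((\<xi> q \<bullet> i) * (\<eta> q \<bullet> j)) *\<^sub>R B (F q) i j)"
    by (intro smooth_intros assms(1,7,8)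
        smooth_on_compose[OF assms(1,2,5,6), of "\<lambda>y. B y i j" for i j] assms(4))
qed

text \<open>One term for the base point with frozen arguments, and one for each argument. The first
  is a directional derivative on the target side, the form in which derivatives of Christoffel
  vectors occur in the curvature.\<close>

lemma dirderiv_bilinear_field:
  fixes B :: "'b::euclidean_space \<Rightarrow> 'c::euclidean_space \<Rightarrow> 'd::euclidean_space \<Rightarrow> 'e::real_normed_vector"
  assumes "open S" "open V" "\<And>y. y \<in> V \<Longrightarrow> bilinear (B y)"
    and "\<And>a b. smooth_on V (\<lambda>y. B y a b)"
    and "smooth_on S F" "F ` S \<subseteq> V" "smooth_on S \<xi>" "smooth_on S \<eta>" "x \<in> S"
  shows "dirderiv (\<lambda>q. B (F q) (\<xi> q) (\<eta> q)) x v =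
    dirderiv (\<lambda>y. B y (\<xi> x) (\<eta> x)) (F x) (dirderiv F x v)
    + B (F x) (dirderiv \<xi> x v) (\<eta> x) + B (F x) (\<xi> x) (dirderiv \<eta> x v)"
proof -
  have Fx: "F x \<in> V"
    using assms by auto
  note hd = smooth_on_has_derivative[OF _ assms(9)]
  have B': "((\<lambda>q. B (F q) i j) has_derivative
      (\<lambda>v. dirderiv (\<lambda>y. B y i j) (F x) (dirderiv F x v))) (at x)" for i j
    using has_derivative_compose[OF hd[OF assms(5)] smooth_on_has_derivative[OF assms(4) Fx]] .
  define D where "D = (\<lambda>v. \<Sum>i\<in>Basis. \<Sum>j\<in>Basis.
      ((\<xi> x \<bullet> i) * (\<eta> x \<bullet> j)) *\<^sub>R dirderiv (\<lambda>y. B y i j) (F x) (dirderiv F x v)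
      + ((\<xi> x \<bullet> i) * (dirderiv \<eta> x v \<bullet> j) + (dirderiv \<xi> x v \<bullet> i) * (\<eta> x \<bullet> j)) *\<^sub>R B (F x) i j)"
  have "((\<lambda>q. \<Sum>i\<in>Basis. \<Sum>j\<in>Basis. ((\<xi> q \<bullet> i) * (\<eta> q \<bullet> j)) *\<^sub>R B (F q) i j) has_derivative D) (at x)"
    unfolding D_def
    by (intro has_derivative_sum has_derivative_scaleR has_derivative_mult
        has_derivative_inner_left hd assms(7,8) B')
  then have "((\<lambda>q. B (F q) (\<xi> q) (\<eta> q)) has_derivative D) (at x)"
    by (rule has_derivative_transform_within_open[OF _ assms(1,9)])
      (use assms(3,6) in \<open>auto intro!: bilinear_sum_Basis[symmetric]\<close>)
  then have "dirderiv (\<lambda>q. B (F q) (\<xi> q) (\<eta> q)) x v = D v"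
    by (rule dirderiv_eqI)
  moreover have "dirderiv (\<lambda>y. B y (\<xi> x) (\<eta> x)) (F x) w =
      (\<Sum>i\<in>Basis. \<Sum>j\<in>Basis. ((\<xi> x \<bullet> i) * (\<eta> x \<bullet> j)) *\<^sub>R dirderiv (\<lambda>y. B y i j) (F x) w)" for w
  proof (rule dirderiv_eqI, rule has_derivative_transform_within_open[OF _ assms(2) Fx])
    show "((\<lambda>y. \<Sum>i\<in>Basis. \<Sum>j\<in>Basis. ((\<xi> x \<bullet> i) * (\<eta> x \<bullet> j)) *\<^sub>R B y i j) has_derivative
      (\<lambda>w. \<Sum>i\<in>Basis. \<Sum>j\<in>Basis. ((\<xi> x \<bullet> i) * (\<eta> x \<bullet> j)) *\<^sub>R dirderiv (\<lambda>y. B y i j) (F x) w)) (at (F x))"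
      by (intro has_derivative_sum has_derivative_scaleR_right smooth_on_has_derivative[OF assms(4) Fx])
  qed (use assms(3) in \<open>auto intro!: bilinear_sum_Basis[symmetric]\<close>)
  ultimately show ?thesis
    unfolding D_def bilinear_sum_Basis[OF assms(3)[OF Fx], of "dirderiv \<xi> x v"]
      bilinear_sum_Basis[OF assms(3)[OF Fx], of _ "dirderiv \<eta> x v"]
    by (simp only: sum.distrib scaleR_add_left ac_simps)
qed

section \<open>Linear forms represented by Cramer's rule\<close>

definition riesz :: "(real^'n \<Rightarrow> real^'n \<Rightarrow> real) \<Rightarrow> (real^'n \<Rightarrow> real) \<Rightarrow> real^'n" where
  "riesz G L = (\<chi> k. det (\<chi> i j. if j = k then L (axis i 1) else G (axis j 1) (axis i 1))
     / det (\<chi> i j. G (axis j 1) (axis i 1)))"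

lemma linear_eq_sum_axis:
  fixes L :: "real^'n \<Rightarrow> 'b::real_vector"
  assumes "linear L"
  shows "L v = (\<Sum>j\<in>UNIV. (v $ j) *\<^sub>R L (axis j 1))"
proof -
  have "v = (\<Sum>j\<in>UNIV. (v $ j) *\<^sub>R axis j 1)"
    by (simp add: vec_eq_iff axis_def sum.delta if_distrib cong: if_cong)
  then have "L v = L (\<Sum>j\<in>UNIV. (v $ j) *\<^sub>R axis j 1)"
    by simp
  then show ?thesis
    by (simp add: assms linear_sum linear_scale)
qed

lemma gram_mult:
  fixes G :: "real^'n \<Rightarrow> real^'n \<Rightarrow> real"
  assumes "bilinear G"
  shows "(\<chi> i j. G (axis j 1) (axis i 1)) *v y = (\<chi> i. G y (axis i 1))"
proof -
  have "(\<Sum>j\<in>UNIV. G (axis j 1) (axis i 1) * y $ j) = G y (axis i 1)" for i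
    using linear_eq_sum_axis[of "\<lambda>y. G y (axis i 1)" y] assms
    by (simp add: bilinear_def mult.commute)
  then show ?thesis
    by (simp add: matrix_vector_mult_def)
qed

text \<open>A vector in the kernel of the Gram matrix is \<open>G\<close>-orthogonal to every axis
  vector, hence to itself, and positivity forces it to vanish.\<close>

lemma det_gram_nonzero:
  fixes G :: "real^'n \<Rightarrow> real^'n \<Rightarrow> real"
  assumes "bilinear G" "\<And>v. v \<noteq> 0 \<Longrightarrow> G v v > 0"
  shows "det (\<chi> i j. G (axis j 1) (axis i 1)) \<noteq> 0"
proof -
  let ?A = "\<chi> i j. G (axis j 1) (axis i 1)"
  have "y = 0" if "?A *v y = 0" for y
  proof (rule ccontr)
    have "G y (axis i 1) = 0" for i
      using that by (simp add: gram_mult[OF assms(1)] vec_eq_iff)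
    then have "G y y = 0"
      using linear_eq_sum_axis[of "G y" y] assms(1) by (simp add: bilinear_def)
    moreover assume "y \<noteq> 0"
    ultimately show False
      using assms(2) by fastforce
  qed
  then show ?thesis
    by (metis invertible_det_nz invertible_left_inverse matrix_left_invertible_ker)
qed

text \<open>Existence and uniqueness in one equivalence: this evaluates the \<open>THE\<close> in
  \<open>christoffel\<close> and, through \<open>tangential\<close>, the one in
  \<open>normal_part\<close>. By linearity the equation need only be tested on axis vectors, where
  it is a linear system with the Gram matrix.\<close>

lemma riesz_unique:
  fixes G :: "real^'n \<Rightarrow> real^'n \<Rightarrow> real"
  assumes "bilinear G" "\<And>v. v \<noteq> 0 \<Longrightarrow> G v v > 0" "linear L"
  shows "(\<forall>z. G y z = L z) \<longleftrightarrow> y = riesz G L"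
proof -
  have "(\<forall>z. G y z = L z) \<longleftrightarrow> (\<forall>i. G y (axis i 1) = L (axis i 1))"
  proof
    assume *: "\<forall>i. G y (axis i 1) = L (axis i 1)"
    have "linear (G y)"
      using assms(1) by (simp add: bilinear_def)
    then show "\<forall>z. G y z = L z"
      by (metis (no_types, lifting) * linear_eq_sum_axis[of "G y"] linear_eq_sum_axis[OF assms(3)]
          sum.cong)
  qed simp
  also have "\<dots> \<longleftrightarrow> (\<chi> i j. G (axis j 1) (axis i 1)) *v y = (\<chi> i. L (axis i 1))"
    by (simp add: gram_mult[OF assms(1)] vec_eq_iff)
  also have "\<dots> \<longleftrightarrow> y = riesz G L"
    using cramer[OF det_gram_nonzero[OF assms(1,2)], of y "\<chi> i. L (axis i 1)"]
    by (simp add: riesz_def cong: if_cong)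
  finally show ?thesis .
qed

lemma smooth_on_det:
  assumes "open S" "\<And>i j. smooth_on S (\<lambda>x. A x $ i $ j)"
  shows "smooth_on S (\<lambda>x. det (A x :: real^'n^'n))"
  unfolding det_def by (intro smooth_intros assms)

lemma smooth_on_riesz:
  fixes G :: "'a::euclidean_space \<Rightarrow> real^'n \<Rightarrow> real^'n \<Rightarrow> real"
  assumes "open S" "\<And>x. x \<in> S \<Longrightarrow> bilinear (G x)" "\<And>x v. x \<in> S \<Longrightarrow> v \<noteq> 0 \<Longrightarrow> G x v v > 0"
    and "\<And>a b. smooth_on S (\<lambda>x. G x a b)" "\<And>b. smooth_on S (\<lambda>x. L x b)"
  shows "smooth_on S (\<lambda>x. riesz (G x) (L x))"
proof -
  define K where "K = (\<lambda>k x. det (\<chi> i j. if j = k then L x (axis i 1) else G x (axis j 1) (axis i 1))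
     * inverse (det (\<chi> i j. G x (axis j 1) (axis i 1))))"
  have "riesz (G x) (L x) = (\<Sum>k\<in>UNIV. K k x *\<^sub>R axis k 1)" for x
    by (simp add: riesz_def K_def vec_eq_iff axis_def sum.delta if_distrib divide_inverse cong: if_cong)
  moreover have "smooth_on S (K k)" for k
  proof -
    have "smooth_on S (\<lambda>x. if j = k then L x (axis i 1) else G x (axis j 1) (axis i 1))" for i j
      using assms(4,5) by (cases "j = k") auto
    then show ?thesis
      unfolding K_def
      by (intro smooth_intros smooth_on_inverse smooth_on_det det_gram_nonzero)
        (simp_all add: assms)
  qed
  ultimately show ?thesis
    by (simp add: smooth_on_sum smooth_on_scaleR smooth_on_const assms(1))
qed

section \<open>Covariant derivatives along maps\<close>

lemma bilinear_simps:
  assumes "bilinear B"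
  shows "B (a + b) c = B a c + B b c" "B a (b + c) = B a b + B a c"
    "B (a - b) c = B a c - B b c" "B a (b - c) = B a b - B a c"
    "B (r *\<^sub>R a) c = r *\<^sub>R B a c" "B a (r *\<^sub>R c) = r *\<^sub>R B a c"
    "B 0 c = 0" "B a 0 = 0" "B (- a) c = - B a c" "B a (- c) = - B a c"
  using assms
  by (simp_all add: bilinear_ladd bilinear_radd bilinear_lsub bilinear_rsub bilinear_lmul
      bilinear_rmul bilinear_lzero bilinear_rzero bilinear_lneg bilinear_rneg)

text \<open>A metric in a single chart. The set \<open>S\<close> may be smaller than the chart
  image, because the source metric is later restricted to the part that the immersion sends into the
  target chart.\<close>

locale smooth_metric =
  fixes g :: "(real^'n) coord_metric" and S :: "(real^'n) set"
  assumes open_domain: "open S"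
    and smooth: "smooth_on S (\<lambda>x. g x v w)"
    and bilinear: "x \<in> S \<Longrightarrow> bilinear (g x)"
    and sym: "x \<in> S \<Longrightarrow> g x v w = g x w v"
    and pos: "x \<in> S \<Longrightarrow> v \<noteq> 0 \<Longrightarrow> g x v v > 0"
begin

lemmas metric_simps = bilinear_simps[OF bilinear]

lemma eqI: "x \<in> S \<Longrightarrow> (\<And>z. g x y z = g x y' z) \<Longrightarrow> y = y'"
  using pos[of x "y - y'"] metric_simps(3)[of x y y' "y - y'"] by force

definition koszul :: "real^'n \<Rightarrow> real^'n \<Rightarrow> real^'n \<Rightarrow> real^'n \<Rightarrow> real" where
  "koszul x v w z =
    dirderiv (\<lambda>q. g q w z) x v + dirderiv (\<lambda>q. g q v z) x w - dirderiv (\<lambda>q. g q v w) x z"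

lemma dirderiv_metric_add:
  assumes "x \<in> S"
  shows "dirderiv (\<lambda>q. g q (a + b) c) x v = dirderiv (\<lambda>q. g q a c) x v + dirderiv (\<lambda>q. g q b c) x v"
proof -
  have "dirderiv (\<lambda>q. g q (a + b) c) x v = dirderiv (\<lambda>q. g q a c + g q b c) x v"
    by (rule dirderiv_cong[OF open_domain assms smooth]) (rule metric_simps)
  then show ?thesis
    by (simp add: dirderiv_add[OF smooth smooth assms])
qed

lemma dirderiv_metric_scaleR:
  assumes "x \<in> S"
  shows "dirderiv (\<lambda>q. g q (r *\<^sub>R a) c) x v = r * dirderiv (\<lambda>q. g q a c) x v"
proof -
  have "dirderiv (\<lambda>q. g q (r *\<^sub>R a) c) x v = dirderiv (\<lambda>q. r *\<^sub>R g q a c) x v"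
    by (rule dirderiv_cong[OF open_domain assms smooth]) (rule metric_simps)
  then show ?thesis
    using dirderiv_scaleR_const[OF smooth assms, of r] by simp
qed

lemma dirderiv_metric_sym:
  assumes "x \<in> S"
  shows "dirderiv (\<lambda>q. g q a b) x v = dirderiv (\<lambda>q. g q b a) x v"
  by (rule dirderiv_cong[OF open_domain assms smooth]) (rule sym)

lemma linear_dirderiv_metric: "x \<in> S \<Longrightarrow> linear (dirderiv (\<lambda>q. g q a b) x)"
  using linear_dirderiv[OF smooth] .

lemma linear_koszul:
  assumes "x \<in> S"
  shows "linear (\<lambda>v. koszul x v w z)" "linear (\<lambda>w. koszul x v w z)" "linear (\<lambda>z. koszul x v w z)"
proof -
  note d = dirderiv_metric_sym[OF assms]
  have *: "linear (\<lambda>a. dirderiv (\<lambda>q. g q a b) x c)" "linear (\<lambda>a. dirderiv (\<lambda>q. g q b a) x c)" for b c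
  proof -
    show "linear (\<lambda>a. dirderiv (\<lambda>q. g q a b) x c)" for b c
      by (rule linearI) (simp_all add: assms dirderiv_metric_add dirderiv_metric_scaleR)
    then show "linear (\<lambda>a. dirderiv (\<lambda>q. g q b a) x c)"
      by (simp add: d[of b])
  qed
  note ** = linear_dirderiv_metric[OF assms]
  show "linear (\<lambda>v. koszul x v w z)" "linear (\<lambda>w. koszul x v w z)" "linear (\<lambda>z. koszul x v w z)"
    unfolding koszul_def by (intro linear_compose_add linear_compose_sub * **)+
qed

lemma koszul_sym: "x \<in> S \<Longrightarrow> koszul x v w z = koszul x w v z"
  unfolding koszul_def using dirderiv_metric_sym[of x v w z] by simp

lemma christoffel_eq_riesz:
  assumes "x \<in> S"
  shows "christoffel g x v w = riesz (g x) (\<lambda>z. koszul x v w z / 2)"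
proof -
  have "linear (\<lambda>z. koszul x v w z / 2)"
    using linear_compose_scale_right[OF linear_koszul(3)[OF assms], of "1 / 2"] by simp
  from riesz_unique[OF bilinear pos this, OF assms assms]
  have "(\<forall>z. 2 * g x y z = koszul x v w z) \<longleftrightarrow> y = riesz (g x) (\<lambda>z. koszul x v w z / 2)" for y
    by (simp add: field_simps)
  then show ?thesis
    unfolding christoffel_def koszul_def[symmetric] by simp
qed

lemma metric_christoffel:
  assumes "x \<in> S"
  shows "g x (christoffel g x v w) z = koszul x v w z / 2"
proof -
  have "linear (\<lambda>z. koszul x v w z / 2)"
    using linear_compose_scale_right[OF linear_koszul(3)[OF assms], of "1 / 2"] by simp
  from riesz_unique[OF bilinear pos this, OF assms assms] show ?thesis
    using christoffel_eq_riesz[OF assms] by blast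
qed

lemma christoffel_sym: "x \<in> S \<Longrightarrow> christoffel g x v w = christoffel g x w v"
  by (simp add: christoffel_eq_riesz koszul_sym[of x v w])

lemma bilinear_christoffel:
  assumes "x \<in> S"
  shows "bilinear (christoffel g x)"
proof -
  have "linear (\<lambda>v. christoffel g x v w)" for w
    by (rule linearI; rule eqI[OF assms])
      (simp_all add: metric_simps[OF assms] metric_christoffel[OF assms]
        linear_add[OF linear_koszul(1)[OF assms]] linear_scale[OF linear_koszul(1)[OF assms]]
        add_divide_distrib)
  then show ?thesis
    by (simp add: bilinear_def christoffel_sym[OF assms])
qed

lemmas christoffel_simps = bilinear_simps[OF bilinear_christoffel]

lemma smooth_on_christoffel: "smooth_on S (\<lambda>x. christoffel g x v w)"
proof (rule smooth_on_cong[OF open_domain christoffel_eq_riesz])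
  have half: "smooth_on S (\<lambda>x. k x / 2)" if "smooth_on S k" for k :: "real^'n \<Rightarrow> real"
    using smooth_on_mult[OF open_domain smooth_on_const[OF open_domain, of "1/2"] that] by simp
  show "smooth_on S (\<lambda>x. riesz (g x) (\<lambda>z. koszul x v w z / 2))"
    by (intro smooth_on_riesz[OF open_domain bilinear pos smooth] half)
      (auto simp: koszul_def intro!: smooth_intros open_domain smooth_on_dirderiv smooth)
qed

text \<open>Metric compatibility: in the sum of the Koszul expressions for \<open>v, a, b\<close>
  and \<open>v, b, a\<close> everything cancels except twice the derivative along
  \<open>v\<close>.\<close>

lemma dirderiv_metric:
  assumes "x \<in> S"
  shows "dirderiv (\<lambda>q. g q a b) x v = g x (christoffel g x v a) b + g x a (christoffel g x v b)"
proof -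
  have "g x a (christoffel g x v b) = koszul x v b a / 2"
    using sym[OF assms] metric_christoffel[OF assms] by metis
  then show ?thesis
    unfolding metric_christoffel[OF assms] koszul_def
    using dirderiv_metric_sym[OF assms, of a b v] by (simp add: field_simps)
qed

lemma christoffel_eqI:
  assumes "x \<in> S" "\<And>z. 2 * g x y z = koszul x v w z"
  shows "y = christoffel g x v w"
  using assms by (intro eqI[OF assms(1)]) (simp add: metric_christoffel field_simps)

end

text \<open>The last term is what the vanishing bracket of constant fields leaves behind. It stays
  because \<open>x\<close> is arbitrary here, and linearity of the Christoffel vectors is available
  only inside the domain of a metric.\<close>

lemma curvature_eq:
  "curvature g x v w z =
    dirderiv (\<lambda>q. christoffel g q w z) x v - dirderiv (\<lambda>q. christoffel g q v z) x w
    + christoffel g x v (christoffel g x w z) - christoffel g x w (christoffel g x v z)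
    - christoffel g x 0 z"
proof -
  have "covariant_deriv g (\<lambda>_. v) (\<lambda>_. z) = (\<lambda>q. christoffel g q v z)" for v
    by (rule ext) (simp add: covariant_deriv_def)
  then show ?thesis
    by (simp add: curvature_def curvature_fields_def covariant_deriv_def lie_bracket_def)
qed

text \<open>Fields along \<open>F\<close> have values in the ambient model space and need not be
  tangent to the image. The instances are the immersion and the identity of a coordinate domain, so
  each rule for \<open>D\<close> serves the extrinsic and the intrinsic connection alike.\<close>

locale smooth_map_to_metric = smooth_metric g V
  for g :: "(real^'k) coord_metric" and V +
  fixes F :: "real^'n \<Rightarrow> real^'k" and U :: "(real^'n) set"
  assumes open_source: "open U" and smooth_map: "smooth_on U F" and map_into: "F ` U \<subseteq> V"
begin

abbreviation D :: "real^'n \<Rightarrow> (real^'n \<Rightarrow> real^'k) \<Rightarrow> real^'n \<Rightarrow> real^'k" where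
  "D v \<xi> \<equiv> covariant_deriv_along g F (\<lambda>_. v) \<xi>"

abbreviation dF :: "real^'n \<Rightarrow> real^'n \<Rightarrow> real^'k" where
  "dF w \<equiv> \<lambda>q. dirderiv F q w"

lemma in_V: "x \<in> U \<Longrightarrow> F x \<in> V"
  using map_into by auto

lemmas smooth_dF = smooth_on_dirderiv[OF smooth_map]

lemma D_eq: "D v \<xi> x = dirderiv \<xi> x v + christoffel g (F x) (dF v x) (\<xi> x)"
  by (simp add: covariant_deriv_along_def)

lemma smooth_D:
  assumes "smooth_on U \<xi>"
  shows "smooth_on U (D v \<xi>)"
  unfolding D_eq
  by (intro smooth_on_add[OF open_source] smooth_on_dirderiv assms
      smooth_on_bilinear_field[OF open_source open_domain bilinear_christoffel
        smooth_on_christoffel smooth_map map_into] smooth_map)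

lemma smooth_on_metric_along:
  assumes "smooth_on U \<xi>" "smooth_on U \<eta>"
  shows "smooth_on U (\<lambda>q. g (F q) (\<xi> q) (\<eta> q))"
  by (intro smooth_on_bilinear_field[OF open_source open_domain bilinear
        smooth smooth_map map_into] assms)

lemma dirderiv_metric_along:
  assumes "smooth_on U \<xi>" "smooth_on U \<eta>" "x \<in> U"
  shows "dirderiv (\<lambda>q. g (F q) (\<xi> q) (\<eta> q)) x v =
    g (F x) (D v \<xi> x) (\<eta> x) + g (F x) (\<xi> x) (D v \<eta> x)"
  using dirderiv_bilinear_field[OF open_source open_domain bilinear smooth smooth_map map_into assms]
  by (simp add: dirderiv_metric D_eq metric_simps in_V assms(3))

text \<open>Torsion-freeness along \<open>F\<close>: mixed second derivatives of \<open>F\<close>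
  commute, and Christoffel vectors are symmetric.\<close>

lemma D_dF_sym:
  assumes "x \<in> U"
  shows "D v (dF w) x = D w (dF v) x"
  unfolding D_eq
  using dirderiv_commute[OF open_source assms smooth_map, of w v] christoffel_sym[OF in_V[OF assms]]
  by simp

text \<open>Exchanging \<open>v\<close> and \<open>w\<close> cancels the second derivatives of
  \<open>\<xi>\<close> and of \<open>F\<close>, and also the two terms with a first derivative of
  \<open>\<xi>\<close>, which are exchanged with each other. The derivative and the square of the
  Christoffel vectors survive, and they form the curvature.\<close>

lemma D_commutator:
  assumes "smooth_on U \<xi>" "x \<in> U"
  shows "D v (D w \<xi>) x - D w (D v \<xi>) x = curvature g (F x) (dF v x) (dF w x) (\<xi> x)"
proof -
  note FV = in_V[OF assms(2)]
  have *: "D v (D w \<xi>) x =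
      dirderiv (\<lambda>q. dirderiv \<xi> q w) x v
      + dirderiv (\<lambda>y. christoffel g y (dF w x) (\<xi> x)) (F x) (dF v x)
      + christoffel g (F x) (dirderiv (dF w) x v) (\<xi> x)
      + christoffel g (F x) (dF w x) (dirderiv \<xi> x v)
      + christoffel g (F x) (dF v x) (dirderiv \<xi> x w)
      + christoffel g (F x) (dF v x) (christoffel g (F x) (dF w x) (\<xi> x))" for v w
  proof -
    have sm: "smooth_on U (\<lambda>q. christoffel g (F q) (dF w q) (\<xi> q))"
      by (intro smooth_on_bilinear_field[OF open_source open_domain bilinear_christoffel
        smooth_on_christoffel smooth_map map_into] smooth_dF assms)
    have "dirderiv (D w \<xi>) x v = dirderiv (\<lambda>q. dirderiv \<xi> q w) x v
      + dirderiv (\<lambda>q. christoffel g (F q) (dF w q) (\<xi> q)) x v"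
      unfolding D_eq by (rule dirderiv_add[OF smooth_on_dirderiv[OF assms(1)] sm assms(2)])
    then show ?thesis
      using dirderiv_bilinear_field[OF open_source open_domain bilinear_christoffel
        smooth_on_christoffel smooth_map map_into smooth_dF assms, of w v]
      unfolding D_eq[of v "D w \<xi>"] by (simp add: D_eq christoffel_simps FV)
  qed
  show ?thesis
    unfolding * curvature_eq
    using dirderiv_commute[OF open_source assms(2,1), of v w]
      dirderiv_commute[OF open_source assms(2) smooth_map, of v w]
    by (simp add: christoffel_simps FV)
qed

lemma metric_second_derivative:
  assumes "smooth_on U \<xi>" "smooth_on U \<eta>" "x \<in> U"
  shows "g (F x) (D v (D w \<xi>) x) (\<eta> x) =
    dirderiv (\<lambda>q. g (F q) (D w \<xi> q) (\<eta> q)) x v - g (F x) (D w \<xi> x) (D v \<eta> x)"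
  using dirderiv_metric_along[OF smooth_D[OF assms(1)] assms(2,3)] by simp

text \<open>Pairing with \<open>\<eta>\<close> turns second covariant derivatives into ordinary
  derivatives of scalar functions. In this form two curvatures can be compared by comparing those
  functions.\<close>

lemma metric_curvature:
  assumes "smooth_on U \<xi>" "smooth_on U \<eta>" "x \<in> U"
  shows "g (F x) (curvature g (F x) (dF v x) (dF w x) (\<xi> x)) (\<eta> x) =
    dirderiv (\<lambda>q. g (F q) (D w \<xi> q) (\<eta> q)) x v - g (F x) (D w \<xi> x) (D v \<eta> x)
    - (dirderiv (\<lambda>q. g (F q) (D v \<xi> q) (\<eta> q)) x w - g (F x) (D v \<xi> x) (D w \<eta> x))"
  unfolding D_commutator[OF assms(1,3), symmetric]
  by (simp add: metric_simps in_V assms metric_second_derivative)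

end

section \<open>Algebraic symmetries of the curvature tensor\<close>

context smooth_metric
begin

sublocale identity: smooth_map_to_metric g S "\<lambda>x. x" S
  by unfold_locales (auto intro: smooth_on_ident open_domain)

lemma D_identity: "covariant_deriv_along g (\<lambda>x. x) (\<lambda>_. v) (\<lambda>_. w) = (\<lambda>q. christoffel g q v w)"
  by (rule ext) (simp add: covariant_deriv_along_def)

lemma metric_curvature_const:
  assumes "x \<in> S"
  shows "g x (curvature g x v w z) t =
    dirderiv (\<lambda>q. g q (christoffel g q w z) t) x v - g x (christoffel g x w z) (christoffel g x v t)
    - (dirderiv (\<lambda>q. g q (christoffel g q v z) t) x w - g x (christoffel g x v z) (christoffel g x w t))"
  using identity.metric_curvature[OF smooth_on_const[OF open_domain] smooth_on_const[OF open_domain] assms]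
  by (simp add: D_identity)

text \<open>As \<open>curvature\<close> is built from constant fields, linearity is inherited from
  the Christoffel vectors. It passes to their directional derivatives because it holds on the whole
  open set \<open>S\<close>.\<close>

lemma linear_curvature:
  assumes "x \<in> S"
  shows "linear (\<lambda>v. curvature g x v w z)" "linear (\<lambda>w. curvature g x v w z)"
    "linear (\<lambda>z. curvature g x v w z)"
proof -
  note lin = linear_compose_add linear_compose_sub linear_dirderiv[OF smooth_on_christoffel assms]
  have G: "linear (christoffel g x a)" "linear (\<lambda>b. christoffel g x b a)" for a
    using bilinear_christoffel[OF assms] by (simp_all add: bilinear_def)
  have 1: "linear (\<lambda>a. dirderiv (\<lambda>q. christoffel g q b a) x c)" for b c
  proof (rule linearI)
    show "dirderiv (\<lambda>q. christoffel g q b (a + a')) x c =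
        dirderiv (\<lambda>q. christoffel g q b a) x c + dirderiv (\<lambda>q. christoffel g q b a') x c" for a a'
      unfolding dirderiv_add[OF smooth_on_christoffel smooth_on_christoffel assms, symmetric]
      by (rule dirderiv_cong[OF open_domain assms smooth_on_christoffel]) (rule christoffel_simps)
    show "dirderiv (\<lambda>q. christoffel g q b (r *\<^sub>R a)) x c =
        r *\<^sub>R dirderiv (\<lambda>q. christoffel g q b a) x c" for r a
      unfolding dirderiv_scaleR_const[OF smooth_on_christoffel assms, symmetric]
      by (rule dirderiv_cong[OF open_domain assms smooth_on_christoffel]) (rule christoffel_simps)
  qed
  have 2: "linear (\<lambda>a. dirderiv (\<lambda>q. christoffel g q a b) x c)" for b c
  proof -
    have "dirderiv (\<lambda>q. christoffel g q a b) x c = dirderiv (\<lambda>q. christoffel g q b a) x c" for a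
      by (rule dirderiv_cong[OF open_domain assms smooth_on_christoffel]) (rule christoffel_sym)
    then show ?thesis
      using 1[of b c] by simp
  qed
  note G' = linear_compose[OF G(1) G(1), unfolded o_def] linear_compose[OF G(2) G(1), unfolded o_def]
    linear_compose[OF G(1) G(2), unfolded o_def] linear_compose[OF G(2) G(2), unfolded o_def]
  show "linear (\<lambda>v. curvature g x v w z)" "linear (\<lambda>w. curvature g x v w z)"
    "linear (\<lambda>z. curvature g x v w z)"
    unfolding curvature_eq christoffel_simps(7)[OF assms] diff_zero
    by (intro lin 1 2 G G')+
qed

lemma curvature_skew: "x \<in> S \<Longrightarrow> curvature g x v w z = - curvature g x w v z"
  by (simp add: curvature_eq christoffel_simps)

lemma curvature_bianchi:
  assumes "x \<in> S"
  shows "curvature g x u v w + curvature g x v w u + curvature g x w u v = 0"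
proof -
  have "dirderiv (\<lambda>q. christoffel g q a b) x c = dirderiv (\<lambda>q. christoffel g q b a) x c" for a b c
    by (rule dirderiv_cong[OF open_domain assms smooth_on_christoffel]) (rule christoffel_sym)
  from this[of v w u] this[of u w v] this[of u v w] show ?thesis
    using christoffel_sym[OF assms, of u v] christoffel_sym[OF assms, of u w]
      christoffel_sym[OF assms, of v w]
    by (simp add: curvature_eq christoffel_simps assms)
qed

text \<open>By metric compatibility \<open>g q (christoffel g q w z) z\<close> is half the
  derivative of \<open>g q z z\<close> along \<open>w\<close>, so the antisymmetrised derivative
  vanishes by the symmetry of second derivatives.\<close>

lemma metric_curvature_diag:
  assumes "x \<in> S"
  shows "g x (curvature g x v w z) z = 0"
proof -
  have half: "dirderiv (\<lambda>q. g q (christoffel g q w z) z) x v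
      = dirderiv (\<lambda>q. dirderiv (\<lambda>q. g q z z) q w) x v / 2" for v w
  proof -
    have "dirderiv (\<lambda>q. dirderiv (\<lambda>q. g q z z) q w) x v
        = dirderiv (\<lambda>q. 2 *\<^sub>R g q (christoffel g q w z) z) x v"
      by (rule dirderiv_cong[OF open_domain assms smooth_on_dirderiv[OF smooth]])
        (simp add: dirderiv_metric sym)
    also have "\<dots> = 2 *\<^sub>R dirderiv (\<lambda>q. g q (christoffel g q w z) z) x v"
      by (rule dirderiv_scaleR_const[OF identity.smooth_on_metric_along[OF smooth_on_christoffel
            smooth_on_const[OF open_domain]] assms])
    finally show ?thesis
      by simp
  qed
  show ?thesis
    unfolding metric_curvature_const[OF assms] half
    using dirderiv_commute[OF open_domain assms smooth, of z z v w] sym[OF assms]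
    by simp
qed

end

text \<open>The difference of a curvature-like form and \<open>c\<close> times the standard one vanishes when the
  sectional curvature is \<open>c\<close>: polarisation makes it alternating, and then Bianchi kills it.\<close>

lemma curvature_like_form_eq:
  fixes G :: "'v::real_vector \<Rightarrow> 'v \<Rightarrow> real" and R :: "'v \<Rightarrow> 'v \<Rightarrow> 'v \<Rightarrow> 'v \<Rightarrow> real"
  assumes G: "bilinear G" "\<And>a b. G a b = G b a" "\<And>a. a \<noteq> 0 \<Longrightarrow> G a a > 0"
    and R: "\<And>b c d. linear (\<lambda>a. R a b c d)" "\<And>a c d. linear (\<lambda>b. R a b c d)"
      "\<And>a b d. linear (\<lambda>c. R a b c d)" "\<And>a b c. linear (\<lambda>d. R a b c d)"
    and skew: "\<And>a b c d. R a b c d = - R b a c d" "\<And>a b c. R a b c c = 0"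
    and bianchi: "\<And>a b c d. R a b c d + R b c a d + R c a b d = 0"
    and sectional: "\<And>a b. G a a = 1 \<Longrightarrow> G b b = 1 \<Longrightarrow> G a b = 0 \<Longrightarrow> R a b b a = c0"
  shows "R a b c d = c0 * (G b c * G a d - G a c * G b d)"
proof -
  note Gs = bilinear_simps[OF G(1)]
  define T where "T = (\<lambda>a b c d. R a b c d - c0 * (G b c * G a d - G a c * G b d))"
  note Rs = R[THEN linear_add] R[THEN linear_scale] R[THEN linear_diff]
  have T_add: "T (a + a') b c d = T a b c d + T a' b c d" "T a (b + b') c d = T a b c d + T a b' c d"
    "T a b (c + c') d = T a b c d + T a b c' d" "T a b c (d + d') = T a b c d + T a b c d'"
    for a b c d a' b' c' d'
    by (simp_all add: T_def Rs Gs algebra_simps)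
  have T_scale: "T (r *\<^sub>R a) b c d = r * T a b c d" "T a (r *\<^sub>R b) c d = r * T a b c d"
    "T a b (r *\<^sub>R c) d = r * T a b c d" "T a b c (r *\<^sub>R d) = r * T a b c d" for a b c d r
    by (simp_all add: T_def Rs Gs algebra_simps)
  have skew1: "T a b c d = - T b a c d" for a b c d
    using skew(1)[of a b c d] by (simp add: T_def algebra_simps)
  have "R a b c d + R a b d c = 0" for a b c d
    using skew(2)[of a b "c + d"] skew(2)[of a b c] skew(2)[of a b d] by (simp add: Rs)
  from this[THEN eq_neg_iff_add_eq_0[THEN iffD2]] have skew2: "T a b c d = - T a b d c" for a b c d
    unfolding T_def by (metis (no_types) minus_diff_eq minus_diff_minus mult.commute mult_minus_right)
  have bianchi': "T a b c d + T b c a d + T c a b d = 0" for a b c d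
    using bianchi[of a b c d]
    by (simp add: T_def G(2)[of b a] G(2)[of c a] G(2)[of c b] algebra_simps)
  have norm: "\<exists>r a'. a = r *\<^sub>R a' \<and> G a' a' = 1" if "a \<noteq> 0" for a
    using G(3)[OF that]
    by (intro exI[of _ "sqrt (G a a)"] exI[of _ "inverse (sqrt (G a a)) *\<^sub>R a"])
      (simp add: Gs field_simps)
  \<comment> \<open>\<open>sectional\<close> speaks of orthonormal pairs; rescaling frees
    \<open>b\<close> from the norm condition, and below \<open>a\<close> as well.\<close>
  have sec0: "T a b b a = 0" if "G a a = 1" "G a b = 0" for a b
  proof (cases "b = 0")
    case True
    then show ?thesis
      using T_scale(2)[of a 0 0 b a] by simp
  next
    case False
    then obtain r b' where b: "b = r *\<^sub>R b'" "G b' b' = 1"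
      using norm by blast
    then have "r \<noteq> 0"
      using False by auto
    then have "G a b' = 0"
      using that b by (simp add: Gs)
    then have "T a b' b' a = 0"
      using sectional[of a b'] that b(2) G(2)[of a b'] by (simp add: T_def)
    then show ?thesis
      by (simp add: b T_scale)
  qed
  have aa: "T a a c d = 0" "T c d a a = 0" for a c d
    using skew1[of a a c d] skew2[of c d a a] by simp_all
  have sec: "T a b b a = 0" for a b
  proof (cases "a = 0")
    case True
    then show ?thesis
      using T_scale(1)[of 0 0 b b a] by simp
  next
    case False
    then obtain r a' where a: "a = r *\<^sub>R a'" "G a' a' = 1"
      using norm by blast
    \<comment> \<open>Gram-Schmidt: the removed multiple of \<open>a'\<close> does not affect
      \<open>T a' b b a'\<close>, since \<open>T\<close> vanishes when its first two or its last two
      arguments agree.\<close>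
    define b' where "b' = b + (- G a' b) *\<^sub>R a'"
    have b: "b = b' + G a' b *\<^sub>R a'"
      by (simp add: b'_def)
    have "G a' b' = 0"
      using a by (simp add: b'_def Gs)
    then have "T a' b' b' a' = 0"
      using sec0 a by blast
    then have "T a' b b a' = 0"
      by (subst b, subst (2) b) (simp add: T_add T_scale aa)
    then show ?thesis
      by (simp add: a T_scale)
  qed
  \<comment> \<open>Four Bianchi identities, one for each argument in last place, combined with the
    two skew symmetries.\<close>
  have pair: "T a b c d = T c d a b" for a b c d
    using bianchi'[of a b c d] bianchi'[of b c d a] bianchi'[of c d a b] bianchi'[of d a b c]
      skew2[of b c d a] skew2[of c d b a] skew1[of d b c a] skew1[of d a c b] skew2[of a d c b]
      skew1[of a c d b] skew2[of c a d b] skew1[of d a b c] skew2[of a b d c] skew2[of b d a c]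
    by linarith
  \<comment> \<open>Polarising \<open>sec\<close> in the outer argument gives
    \<open>T a b b d + T d b b a = 0\<close>, and pair symmetry makes the two summands
    equal.\<close>
  have polar: "T a b b d = 0" for a b d
    using sec[of "a + d" b] sec[of a b] sec[of d b] pair[of d b b a] skew1[of b a d b] skew2[of a b d b]
    by (simp add: T_add)
  have mid: "T a b c d = - T a c b d" for a b c d
    using polar[of a "b + c" d] polar[of a b d] polar[of a c d] unfolding T_add by linarith
  \<comment> \<open>Cyclic permutations are even, so the three Bianchi terms now coincide.\<close>
  have "T a b c d = 0"
    using bianchi'[of a b c d] mid[of b c a d] mid[of a b c d] skew1[of b a c d] skew1[of c a b d]
    by linarith
  then show ?thesis
    by (simp add: T_def)
qed

section \<open>Isometric immersions in coordinates\<close>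

lemma (in smooth_metric) constant_curvature:
  assumes "x \<in> S"
    and "\<And>v w. g x v v = 1 \<Longrightarrow> g x w w = 1 \<Longrightarrow> g x v w = 0 \<Longrightarrow> g x (curvature g x v w w) v = c"
  shows "g x (curvature g x v w z) t = c * (g x w z * g x v t - g x v z * g x w t)"
proof (rule curvature_like_form_eq[of "g x" "\<lambda>v w z t. g x (curvature g x v w z) t"])
  have lin: "linear (g x a)" "linear (\<lambda>b. g x b a)" for a
    using bilinear[OF assms(1)] by (simp_all add: bilinear_def)
  show "linear (\<lambda>v. g x (curvature g x v w z) t)" "linear (\<lambda>w. g x (curvature g x v w z) t)"
    "linear (\<lambda>z. g x (curvature g x v w z) t)" "linear (\<lambda>t. g x (curvature g x v w z) t)" for v w z t
    using linear_compose[OF linear_curvature(1)[OF assms(1)] lin(2)]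
      linear_compose[OF linear_curvature(2)[OF assms(1)] lin(2)]
      linear_compose[OF linear_curvature(3)[OF assms(1)] lin(2)] lin(1)
    by (simp_all add: o_def)
  show "g x (curvature g x a b c) d = - g x (curvature g x b a c) d" for a b c d
    using curvature_skew[OF assms(1), of a b c] by (simp add: metric_simps assms(1))
  show "g x (curvature g x a b c) d + g x (curvature g x b c a) d + g x (curvature g x c a b) d = 0"
    for a b c d
    using arg_cong[OF curvature_bianchi[OF assms(1), of a b c], of "\<lambda>y. g x y d"]
    by (simp add: metric_simps assms(1))
qed (use assms bilinear sym pos metric_curvature_diag in auto)

locale isometric_coord_map =
  target: smooth_map_to_metric g' V F U + source: smooth_metric g U
  for g' :: "(real^'k) coord_metric" and V and F :: "real^'n \<Rightarrow> real^'k" and U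
    and g :: "(real^'n) coord_metric" +
  assumes isometry: "x \<in> U \<Longrightarrow> g' (F x) (dirderiv F x v) (dirderiv F x w) = g x v w"
begin

abbreviation D :: "real^'n \<Rightarrow> (real^'n \<Rightarrow> real^'k) \<Rightarrow> real^'n \<Rightarrow> real^'k" where
  "D \<equiv> target.D"

abbreviation dF :: "real^'n \<Rightarrow> real^'n \<Rightarrow> real^'k" where
  "dF \<equiv> target.dF"

abbreviation G :: "real^'n \<Rightarrow> real^'k \<Rightarrow> real^'k \<Rightarrow> real" where
  "G x \<equiv> g' (F x)"

abbreviation normal :: "real^'n \<Rightarrow> real^'k \<Rightarrow> real^'k" where
  "normal \<equiv> normal_part g' F"

abbreviation II :: "real^'n \<Rightarrow> real^'n \<Rightarrow> real^'n \<Rightarrow> real^'k" where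
  "II \<equiv> second_fundamental_form g' F"

text \<open>A vector of the source, not of the ambient space: its image under \<open>dF\<close> is
  the tangential part of \<open>\<xi>\<close>. By the isometry it can be found with the source
  metric alone.\<close>

definition tangential :: "real^'n \<Rightarrow> real^'k \<Rightarrow> real^'n" where
  "tangential x \<xi> = riesz (g x) (\<lambda>z. G x \<xi> (dF z x))"

lemmas G_simps = target.metric_simps[OF target.in_V]

lemma linear_dF: "x \<in> U \<Longrightarrow> linear (\<lambda>z. dF z x)"
  using linear_dirderiv[OF target.smooth_map] .

lemma tangential_unique:
  assumes "x \<in> U"
  shows "(\<forall>z. g x y z = G x \<xi> (dF z x)) \<longleftrightarrow> y = tangential x \<xi>"
  unfolding tangential_def
proof (rule riesz_unique[OF source.bilinear source.pos])
  have "linear (G x \<xi>)"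
    using target.bilinear[OF target.in_V[OF assms]] by (simp add: bilinear_def)
  then show "linear (\<lambda>z. G x \<xi> (dF z x))"
    using linear_compose[OF linear_dF[OF assms]] by (simp add: o_def)
qed (use assms in auto)

lemma metric_tangential: "x \<in> U \<Longrightarrow> g x (tangential x \<xi>) z = G x \<xi> (dF z x)"
  using tangential_unique by blast

lemma normal_space_iff: "\<eta> \<in> normal_space_at g' F x \<longleftrightarrow> (\<forall>v. G x (dF v x) \<eta> = 0)"
  by (simp add: normal_space_at_def)

lemma normal_eq:
  assumes "x \<in> U"
  shows "normal x \<xi> = \<xi> - dF (tangential x \<xi>) x"
  unfolding normal_part_def
proof (rule the_equality)
  have "G x (dF v x) (\<xi> - dF (tangential x \<xi>) x) = 0" for v
    using metric_tangential[OF assms, of \<xi> v] isometry[OF assms, of v "tangential x \<xi>"]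
      source.sym[OF assms] target.sym[OF target.in_V[OF assms]]
    by (simp add: G_simps assms)
  then show "\<xi> - dF (tangential x \<xi>) x \<in> normal_space_at g' F x \<and>
      \<xi> - (\<xi> - dF (tangential x \<xi>) x) \<in> range (\<lambda>v. dirderiv F x v)"
    by (simp add: normal_space_iff)
  fix \<eta>
  assume *: "\<eta> \<in> normal_space_at g' F x \<and> \<xi> - \<eta> \<in> range (\<lambda>v. dirderiv F x v)"
  then obtain y where y: "\<xi> - \<eta> = dF y x"
    by auto
  have "g x y z = G x \<xi> (dF z x)" for z
  proof -
    have "\<xi> = \<eta> + dF y x"
      using y by (simp add: algebra_simps)
    then have "G x \<xi> (dF z x) = G x (dF z x) \<eta> + g x y z"
      using target.sym[OF target.in_V[OF assms]] isometry[OF assms] by (simp add: G_simps assms)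
    then show ?thesis
      using * by (simp add: normal_space_iff)
  qed
  then have "y = tangential x \<xi>"
    using tangential_unique[OF assms] by blast
  then show "\<eta> = \<xi> - dF (tangential x \<xi>) x"
    using y by (simp add: algebra_simps)
qed

lemma normal_in_normal_space:
  assumes "x \<in> U"
  shows "normal x \<xi> \<in> normal_space_at g' F x"
  using metric_tangential[OF assms, of \<xi>] isometry[OF assms, of _ "tangential x \<xi>"]
    source.sym[OF assms] target.sym[OF target.in_V[OF assms]]
  by (simp add: normal_space_iff normal_eq assms G_simps)

lemma metric_normal:
  assumes "x \<in> U" "\<eta> \<in> normal_space_at g' F x"
  shows "G x (normal x \<xi>) \<eta> = G x \<xi> \<eta>"
  using assms(2) by (simp add: normal_eq assms(1) normal_space_iff G_simps)

lemma tangential_normal: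
  assumes "x \<in> U" "\<eta> \<in> normal_space_at g' F x"
  shows "tangential x \<eta> = 0"
proof -
  have "\<forall>z. g x 0 z = G x \<eta> (dF z x)"
    using assms target.sym[OF target.in_V[OF assms(1)]]
    by (simp add: source.metric_simps normal_space_iff)
  then show ?thesis
    using tangential_unique[OF assms(1)] by metis
qed

lemma normal_normal: "x \<in> U \<Longrightarrow> \<eta> \<in> normal_space_at g' F x \<Longrightarrow> normal x \<eta> = \<eta>"
  using linear_0[OF linear_dF] by (simp add: normal_eq tangential_normal)

lemma smooth_on_tangential:
  assumes "smooth_on U \<xi>"
  shows "smooth_on U (\<lambda>q. tangential q (\<xi> q))"
  unfolding tangential_def
  by (intro smooth_on_riesz target.open_source source.bilinear source.pos source.smooth
      target.smooth_on_metric_along assms target.smooth_dF)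

text \<open>The auxiliary scalar argument turns the differential into a field of bilinear maps, so that
  the rules for those apply.\<close>

lemma bilinear_scaled_differential:
  "x \<in> U \<Longrightarrow> bilinear (\<lambda>a (r::real). r *\<^sub>R dF a x)"
  unfolding bilinear_def
  using linear_compose_scale_right[OF linear_dF] by (auto intro!: linearI simp: scaleR_add_left)

lemma smooth_scaled_differential: "smooth_on U (\<lambda>q. (r::real) *\<^sub>R dF a q)"
  by (intro smooth_intros target.open_source target.smooth_dF)

lemma smooth_on_differential:
  assumes "smooth_on U T"
  shows "smooth_on U (\<lambda>q. dF (T q) q)"
  using smooth_on_bilinear_field[OF target.open_source target.open_source
      bilinear_scaled_differential smooth_scaled_differential
      smooth_on_ident[OF target.open_source] _ assms smooth_on_const[OF target.open_source, of 1]]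
  by simp

lemma smooth_on_normal:
  assumes "smooth_on U \<xi>"
  shows "smooth_on U (\<lambda>q. normal q (\<xi> q))"
  by (rule smooth_on_cong[OF target.open_source normal_eq])
    (auto intro!: smooth_intros target.open_source assms smooth_on_differential smooth_on_tangential)

lemma D_cong:
  assumes "x \<in> U" "smooth_on U \<xi>" "\<And>q. q \<in> U \<Longrightarrow> \<xi> q = \<eta> q"
  shows "D v \<xi> x = D v \<eta> x"
  using dirderiv_cong[OF target.open_source assms] assms(1,3) by (simp add: target.D_eq)

lemma D_diff:
  assumes "x \<in> U" "smooth_on U \<xi>" "smooth_on U \<eta>"
  shows "D v (\<lambda>q. \<xi> q - \<eta> q) x = D v \<xi> x - D v \<eta> x"
  using dirderiv_diff[OF assms(2,3,1)] target.christoffel_simps[OF target.in_V[OF assms(1)]]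
  by (simp add: target.D_eq)

text \<open>The variation of \<open>T\<close> contributes only a tangential vector, which disappears
  when paired with a normal one; what then remains depends on \<open>T x\<close> alone.\<close>

lemma D_differential:
  assumes "x \<in> U" "smooth_on U T"
  shows "D v (\<lambda>q. dF (T q) q) x = dF (dirderiv T x v) x + D v (dF (T x)) x"
  using dirderiv_bilinear_field[OF target.open_source target.open_source
      bilinear_scaled_differential smooth_scaled_differential
      smooth_on_ident[OF target.open_source] _ assms(2) smooth_on_const[OF target.open_source, of 1]
      assms(1), of v]
  by (simp add: target.D_eq)

text \<open>The induced connection is the Levi-Civita connection: by the isometry the source Koszul
  expression differentiates products of \<open>dF\<close> fields, and torsion-freeness cancels all
  but twice the product of \<open>D v (dF w)\<close> with \<open>dF z\<close>.\<close>

lemma tangential_second_derivative: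
  assumes "x \<in> U"
  shows "tangential x (D v (dF w) x) = christoffel g x v w"
proof (rule source.christoffel_eqI[OF assms])
  have *: "dirderiv (\<lambda>q. g q a b) x c = G x (D c (dF a) x) (dF b x) + G x (dF a x) (D c (dF b) x)"
    for a b c
  proof -
    have "dirderiv (\<lambda>q. g q a b) x c = dirderiv (\<lambda>q. G q (dF a q) (dF b q)) x c"
      by (rule dirderiv_cong[OF target.open_source assms source.smooth]) (simp add: isometry)
    then show ?thesis
      by (simp add: target.dirderiv_metric_along[OF target.smooth_dF target.smooth_dF assms])
  qed
  show "2 * g x (tangential x (D v (dF w) x)) z = source.koszul x v w z" for z
    unfolding source.koszul_def * metric_tangential[OF assms]
    using target.D_dF_sym[OF assms] target.sym[OF target.in_V[OF assms]] by simp
qed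

lemma gauss_formula:
  assumes "x \<in> U"
  shows "D v (dF w) x = dF (christoffel g x v w) x + II x v w"
  unfolding second_fundamental_form_def
  using normal_eq[OF assms, of "D v (dF w) x"] tangential_second_derivative[OF assms] by simp

lemma II_in_normal_space: "x \<in> U \<Longrightarrow> II x v w \<in> normal_space_at g' F x"
  unfolding second_fundamental_form_def by (rule normal_in_normal_space)

lemma metric_II:
  "x \<in> U \<Longrightarrow> \<eta> \<in> normal_space_at g' F x \<Longrightarrow> G x (II x v w) \<eta> = G x (D v (dF w) x) \<eta>"
  unfolding second_fundamental_form_def by (rule metric_normal)

lemma II_sym: "x \<in> U \<Longrightarrow> II x v w = II x w v"
  unfolding second_fundamental_form_def using target.D_dF_sym by simp

text \<open>Torsion-freeness moves \<open>w\<close> from the differentiated field into the direction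
  of differentiation, where linearity is immediate.\<close>

lemma linear_metric_II:
  assumes "x \<in> U" "\<eta> \<in> normal_space_at g' F x"
  shows "linear (\<lambda>w. G x (II x v w) \<eta>)"
proof -
  have "linear (\<lambda>w. D w (dF v) x)"
    unfolding target.D_eq
    using target.bilinear_christoffel[OF target.in_V[OF assms(1)]]
      linear_compose[OF linear_dF[OF assms(1)], of "\<lambda>y. christoffel g' (F x) y (dF v x)"]
    by (intro linear_compose_add linear_dirderiv[OF target.smooth_dF assms(1)])
      (simp add: bilinear_def o_def)
  then have "linear (\<lambda>w. G x (D w (dF v) x) \<eta>)"
    using linear_compose[of "\<lambda>w. D w (dF v) x" "\<lambda>y. G x y \<eta>"]
      target.bilinear[OF target.in_V[OF assms(1)]]
    by (simp add: bilinear_def o_def)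
  then show ?thesis
    using target.D_dF_sym[OF assms(1)] by (simp add: metric_II assms)
qed

lemma metric_second_derivatives:
  assumes "x \<in> U"
  shows "G x (D v (dF w) x) (D a (dF b) x) =
    g x (christoffel g x v w) (christoffel g x a b) + G x (II x v w) (II x a b)"
proof -
  have "G x (dF y x) (II x a b) = 0" "G x (II x a b) (dF y x) = 0" for y a b
    using II_in_normal_space[OF assms] target.sym[OF target.in_V[OF assms]]
    by (auto simp: normal_space_iff)
  then show ?thesis
    by (simp add: gauss_formula assms G_simps isometry)
qed

text \<open>Both curvatures are the antisymmetrised derivative of the same function
  \<open>g (\<nabla>\<^sub>w z) t = g' (D w (dF z)) (dF t)\<close>, up to terms without derivatives.\<close>

theorem gauss_equation:
  assumes "x \<in> U"
  shows "G x (curvature g' (F x) (dF v x) (dF w x) (dF z x)) (dF t x) =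
    g x (curvature g x v w z) t - G x (II x w z) (II x v t) + G x (II x v z) (II x w t)"
proof -
  have "dirderiv (\<lambda>q. G q (D w (dF z) q) (dF t q)) x v = dirderiv (\<lambda>q. g q (christoffel g q w z) t) x v"
    for v w
  proof (rule dirderiv_cong[OF target.open_source assms])
    show "G q (D w (dF z) q) (dF t q) = g q (christoffel g q w z) t" if "q \<in> U" for q
      using metric_tangential[OF that] tangential_second_derivative[OF that] by metis
  qed (intro target.smooth_on_metric_along target.smooth_D target.smooth_dF)
  then show ?thesis
    unfolding target.metric_curvature[OF target.smooth_dF target.smooth_dF assms]
      source.metric_curvature_const[OF assms] metric_second_derivatives[OF assms]
    by simp
qed

text \<open>Pairing with a normal \<open>\<eta>\<close> absorbs the outer projection. The inner one
  subtracts a tangential field, whose covariant derivative contributes only through the second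
  fundamental form.\<close>

lemma metric_normal_connection:
  assumes "x \<in> U" "smooth_on U \<xi>" "\<eta> \<in> normal_space_at g' F x"
  shows "G x (normal_connection g' F (\<lambda>_. v) (normal_connection g' F (\<lambda>_. w) \<xi>) x) \<eta> =
    G x (D v (D w \<xi>) x) \<eta> - G x (II x v (tangential x (D w \<xi> x))) \<eta>"
proof -
  define T where "T = (\<lambda>q. tangential q (D w \<xi> q))"
  have smT: "smooth_on U T"
    unfolding T_def by (intro smooth_on_tangential target.smooth_D assms)
  have "D v (normal_connection g' F (\<lambda>_. w) \<xi>) x = D v (\<lambda>q. D w \<xi> q - dF (T q) q) x"
    unfolding normal_connection_def T_def
    by (intro D_cong smooth_on_normal target.smooth_D assms) (simp add: normal_eq)
  also have "\<dots> = D v (D w \<xi>) x - (dF (dirderiv T x v) x + D v (dF (T x)) x)"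
    by (simp add: D_diff D_differential assms smT smooth_on_differential target.smooth_D)
  finally have "G x (D v (normal_connection g' F (\<lambda>_. w) \<xi>) x) \<eta> =
      G x (D v (D w \<xi>) x) \<eta> - G x (D v (dF (T x)) x) \<eta>"
    using assms(3) by (simp add: G_simps assms(1) normal_space_iff)
  then show ?thesis
    by (simp add: normal_connection_def[of g' F "\<lambda>_. v"] metric_normal metric_II assms(1,3) T_def)
qed

text \<open>The Weingarten equation, obtained by differentiating the orthogonality of
  \<open>\<xi>\<close> and \<open>dF z\<close>.\<close>

lemma metric_tangential_derivative:
  assumes "x \<in> U" "smooth_on U \<xi>" "\<And>q. q \<in> U \<Longrightarrow> \<xi> q \<in> normal_space_at g' F q"
  shows "g x (tangential x (D w \<xi> x)) z = - G x (\<xi> x) (II x w z)"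
proof -
  note sym = target.sym[OF target.in_V]
  have "dirderiv (\<lambda>q. G q (\<xi> q) (dF z q)) x w = dirderiv (\<lambda>q. 0) x w"
    by (rule dirderiv_cong[OF target.open_source assms(1)])
      (use assms(2,3) sym in \<open>auto simp: normal_space_iff
        intro!: target.smooth_on_metric_along target.smooth_dF\<close>)
  then have "G x (D w \<xi> x) (dF z x) + G x (\<xi> x) (D w (dF z) x) = 0"
    using target.dirderiv_metric_along[OF assms(2) target.smooth_dF assms(1)] by simp
  moreover have "G x (\<xi> x) (D w (dF z) x) = G x (\<xi> x) (II x w z)"
    using metric_II[OF assms(1) assms(3)[OF assms(1)]] sym[OF assms(1)] by metis
  ultimately show ?thesis
    by (simp add: metric_tangential assms(1))
qed

text \<open>\<open>Tv\<close> and \<open>Tw\<close> are minus the shape operator of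
  \<open>\<zeta>\<close> at \<open>v\<close> and \<open>w\<close>. They are characterised by their
  products, so that they can later be expanded in a basis without reference to a normal field
  extending \<open>\<zeta>\<close>.\<close>

theorem ricci_equation:
  assumes "x \<in> U" "\<zeta> \<in> normal_space_at g' F x" "\<eta> \<in> normal_space_at g' F x"
    and T: "\<And>z. g x Tv z = - G x \<zeta> (II x v z)" "\<And>z. g x Tw z = - G x \<zeta> (II x w z)"
  shows "G x (normal_curvature g' F x v w \<zeta>) \<eta> =
    G x (curvature g' (F x) (dF v x) (dF w x) \<zeta>) \<eta> + G x (II x w Tv) \<eta> - G x (II x v Tw) \<eta>"
proof -
  define \<xi> where "\<xi> = (\<lambda>q. normal q \<zeta>)"
  have sm: "smooth_on U \<xi>"
    unfolding \<xi>_def by (intro smooth_on_normal smooth_on_const target.open_source)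
  have nor: "\<xi> q \<in> normal_space_at g' F q" if "q \<in> U" for q
    unfolding \<xi>_def using normal_in_normal_space[OF that] .
  have \<xi>x: "\<xi> x = \<zeta>"
    by (simp add: \<xi>_def normal_normal assms)
  have "Tv = tangential x (D v \<xi> x)" "Tw = tangential x (D w \<xi> x)"
    by (rule source.eqI[OF assms(1)],
        simp add: T metric_tangential_derivative[OF assms(1) sm nor] \<xi>x)+
  moreover have "normal_connection g' F (lie_bracket (\<lambda>_. v) (\<lambda>_. w)) \<xi> x = 0"
  proof -
    have "covariant_deriv_along g' F (lie_bracket (\<lambda>_. v) (\<lambda>_. w)) \<xi> x = 0"
      using linear_0[OF linear_dirderiv[OF sm assms(1)]] linear_0[OF linear_dF[OF assms(1)]]
      by (simp add: covariant_deriv_along_def lie_bracket_def target.christoffel_simps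
          target.in_V assms(1))
    moreover have "normal x 0 = 0"
      by (simp add: normal_normal assms(1) normal_space_iff G_simps)
    ultimately show ?thesis
      by (simp add: normal_connection_def)
  qed
  ultimately show ?thesis
    unfolding normal_curvature_def normal_curvature_fields_def \<xi>_def[symmetric]
    using arg_cong[OF target.D_commutator[OF sm assms(1), of v w], of "\<lambda>y. G x y \<eta>"]
    by (simp add: G_simps assms(1) metric_normal_connection[OF assms(1) sm assms(3)] \<xi>x)
qed

end

section \<open>Gauss and Ricci equations of a space form in orthonormal bases\<close>

lemma orthonormal_basis_expansion:
  assumes "bilinear G" "orthonormal_basis G W k b" "v \<in> W"
  shows "v = (\<Sum>i=1..k. G v (b i) *\<^sub>R b i)"
proof -
  note Gs = bilinear_simps[OF assms(1)]
  have "v \<in> span (b ` {1..k})"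
    using assms(2,3) by (simp add: orthonormal_basis_def)
  then show ?thesis
  proof (induction rule: span_induct)
    case base
    show ?case
      by (auto simp: subspace_def Gs scaleR_add_left sum.distrib scaleR_sum_right)
        (metis (no_types, lifting) scaleR_scaleR scaleR_sum_right sum.cong)
  next
    case (step x)
    then obtain j where j: "j \<in> {1..k}" "x = b j"
      by auto
    have "(\<Sum>i=1..k. G (b j) (b i) *\<^sub>R b i) = (\<Sum>i=1..k. if i = j then b i else 0)"
      using assms(2) j by (intro sum.cong) (auto simp: orthonormal_basis_def)
    then show ?case
      using j by simp
  qed
qed

lemma orthonormal_basis_parseval:
  assumes "bilinear G" "\<And>a b. G a b = G b a" "orthonormal_basis G W k b" "v \<in> W"
  shows "G v w = (\<Sum>i=1..k. G v (b i) * G w (b i))"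
proof -
  have lin: "linear (\<lambda>a. G a w)"
    using assms(1) by (simp add: bilinear_def)
  have "G v w = G (\<Sum>i=1..k. G v (b i) *\<^sub>R b i) w"
    using orthonormal_basis_expansion[OF assms(1,3,4)] by simp
  also have "\<dots> = (\<Sum>i=1..k. G v (b i) * G (b i) w)"
    by (simp add: linear_sum[OF lin] linear_scale[OF lin])
  finally show ?thesis
    using assms(2)[of _ w] by simp
qed

context isometric_coord_map
begin

context
  fixes x and c :: real
  assumes x: "x \<in> U"
    and sectional: "\<And>v w. G x v v = 1 \<Longrightarrow> G x w w = 1 \<Longrightarrow> G x v w = 0 \<Longrightarrow>
      G x (curvature g' (F x) v w w) v = c"
begin

lemma ambient_curvature:
  "G x (curvature g' (F x) v w z) t = c * (G x w z * G x v t - G x v z * G x w t)"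
  by (rule target.constant_curvature[OF target.in_V[OF x]]) (rule sectional)

lemma gauss_equation_space_form:
  assumes "orthonormal_basis (g x) UNIV n e" "orthonormal_basis (G x) (normal_space_at g' F x) m u"
    and "i \<in> {1..n}" "j \<in> {1..n}" "i \<noteq> j"
  shows "g x (curvature g x (e i) (e j) (e j)) (e i) = c + (\<Sum>\<alpha>=1..m.
    G x (II x (e i) (e i)) (u \<alpha>) * G x (II x (e j) (e j)) (u \<alpha>) - (G x (II x (e i) (e j)) (u \<alpha>))\<^sup>2)"
proof -
  have e: "g x (e i) (e i) = 1" "g x (e j) (e j) = 1" "g x (e i) (e j) = 0" "g x (e j) (e i) = 0"
    using assms by (auto simp: orthonormal_basis_def)
  have *: "G x (II x a b) \<eta> = (\<Sum>\<alpha>=1..m. G x (II x a b) (u \<alpha>) * G x \<eta> (u \<alpha>))" for a b \<eta>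
    by (rule orthonormal_basis_parseval[OF target.bilinear[OF target.in_V[OF x]]
          target.sym[OF target.in_V[OF x]] assms(2) II_in_normal_space[OF x]])
  show ?thesis
    using gauss_equation[OF x, of "e i" "e j" "e j" "e i"] II_sym[OF x, of "e j" "e i"]
      *[of "e i" "e j" "II x (e i) (e j)"] *[of "e j" "e j" "II x (e i) (e i)"]
    unfolding ambient_curvature
    by (simp add: isometry x e sum_subtractf power2_eq_square mult.commute)
qed

text \<open>Every product in the ambient curvature term pairs a tangent with a normal vector, so
  that term vanishes. Expanding the shape operator in the basis \<open>e\<close> makes the rest an
  entry of a commutator of symmetric matrices.\<close>

lemma ricci_equation_space_form:
  assumes "orthonormal_basis (g x) UNIV n e"
    and "\<zeta> \<in> normal_space_at g' F x" "\<eta> \<in> normal_space_at g' F x"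
  shows "G x (normal_curvature g' F x v w \<zeta>) \<eta> = (\<Sum>k=1..n.
    G x (II x v (e k)) \<eta> * G x (II x w (e k)) \<zeta> - G x (II x v (e k)) \<zeta> * G x (II x w (e k)) \<eta>)"
proof -
  define T where "T = (\<lambda>v. riesz (g x) (\<lambda>z. - G x (II x v z) \<zeta>))"
  have T: "g x (T v) z = - G x (II x v z) \<zeta>" for v z
  proof -
    have "linear (\<lambda>z. - G x (II x v z) \<zeta>)"
      using linear_compose_neg[OF linear_metric_II[OF x assms(2)]] .
    from riesz_unique[OF source.bilinear[OF x] source.pos[OF x] this]
    show ?thesis
      unfolding T_def by blast
  qed
  have II_T: "G x (II x a (T b)) \<eta> = (\<Sum>k=1..n. - (G x (II x b (e k)) \<zeta> * G x (II x a (e k)) \<eta>))" for a b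
  proof -
    note lin = linear_metric_II[OF x assms(3), of a]
    have "T b = (\<Sum>k=1..n. g x (T b) (e k) *\<^sub>R e k)"
      by (rule orthonormal_basis_expansion[OF source.bilinear[OF x] assms(1)]) simp
    then have "G x (II x a (T b)) \<eta> = G x (II x a (\<Sum>k=1..n. g x (T b) (e k) *\<^sub>R e k)) \<eta>"
      by simp
    also have "\<dots> = (\<Sum>k=1..n. g x (T b) (e k) * G x (II x a (e k)) \<eta>)"
      by (simp add: linear_sum[OF lin] linear_scale[OF lin])
    finally show ?thesis
      by (simp add: T)
  qed
  have "G x (dF v x) \<zeta> = 0" "G x (dF v x) \<eta> = 0" for v
    using assms(2,3) by (auto simp: normal_space_iff)
  then have "G x (curvature g' (F x) (dF v x) (dF w x) \<zeta>) \<eta> = 0"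
    by (simp add: ambient_curvature)
  moreover have "g x (T v) z = - G x \<zeta> (II x v z)" "g x (T w) z = - G x \<zeta> (II x w z)" for z
    by (simp_all add: T target.sym[OF target.in_V[OF x], of \<zeta>])
  ultimately have "G x (normal_curvature g' F x v w \<zeta>) \<eta> = G x (II x w (T v)) \<eta> - G x (II x v (T w)) \<eta>"
    using ricci_equation[where v = v and w = w and Tv = "T v" and Tw = "T w", OF x assms(2,3)]
    by simp
  then show ?thesis
    by (simp add: II_T sum_subtractf sum_negf mult.commute)
qed

end

end

section \<open>The inequality\<close>

lemma sum_symmetric_eq:
  fixes f :: "nat \<Rightarrow> nat \<Rightarrow> real"
  assumes "\<And>i j. f i j = f j i"
  shows "(\<Sum>i=1..n. \<Sum>j=1..n. f i j) = 2 * (\<Sum>j=1..n. \<Sum>i=1..<j. f i j) + (\<Sum>i=1..n. f i i)"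
proof (induction n)
  case (Suc n)
  have "(\<Sum>i=1..n. f (Suc n) i) = (\<Sum>i=1..n. f i (Suc n))"
    using assms by (intro sum.cong) auto
  then show ?case
    using Suc by (simp add: sum.distrib atLeastLessThanSuc_atLeastAtMost)
qed simp

lemma sum_swap_inner:
  fixes k :: "'a \<Rightarrow> 'b \<Rightarrow> 'c \<Rightarrow> real"
  shows "(\<Sum>j\<in>A. \<Sum>i\<in>B j. \<Sum>x\<in>C. k x i j) = (\<Sum>x\<in>C. \<Sum>j\<in>A. \<Sum>i\<in>B j. k x i j)"
  by (simp only: sum.swap[of _ C])

lemma mat_normsq_eq: "mat_normsq A = (\<Sum>i\<in>UNIV. \<Sum>j\<in>UNIV. (A $ i $ j)\<^sup>2)"
  unfolding mat_normsq_def trace_def matrix_matrix_mult_def transpose_def power2_eq_square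
  by simp (rule sum.swap)

text \<open>Subtracting the trace parts \<open>t \<alpha>\<close> leaves the commutators unchanged, and splits off the
  mean curvature from the sum of squares.\<close>

lemma traceless_matrix_inequality:
  fixes a :: "nat \<Rightarrow> nat \<Rightarrow> nat \<Rightarrow> real"
  assumes n: "CARD('n::finite) = n"
    and matrix_ineq: "\<forall>B :: nat \<Rightarrow> real^'n^'n.
         (\<forall>\<alpha>\<in>{1..m}. transpose (B \<alpha>) = B \<alpha> \<and> trace (B \<alpha>) = 0) \<longrightarrow>
         (\<Sum>\<alpha>=1..m. \<Sum>\<beta>=1..m. mat_normsq (commutator (B \<alpha>) (B \<beta>)))
           \<le> (\<Sum>\<alpha>=1..m. mat_normsq (B \<alpha>))\<^sup>2"
    and a: "\<And>\<alpha> i j. a \<alpha> i j = a \<alpha> j i"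
  defines "t \<equiv> \<lambda>\<alpha>. (\<Sum>i=1..n. a \<alpha> i i) / n"
  shows "(\<Sum>\<alpha>=1..m. \<Sum>\<beta>=1..m. \<Sum>i=1..n. \<Sum>j=1..n.
      (\<Sum>k=1..n. a \<beta> i k * a \<alpha> j k - a \<alpha> i k * a \<beta> j k)\<^sup>2)
    \<le> (\<Sum>\<alpha>=1..m. (\<Sum>i=1..n. \<Sum>j=1..n. (a \<alpha> i j)\<^sup>2) - n * (t \<alpha>)\<^sup>2)\<^sup>2"
proof -
  \<comment> \<open>Matrix indices live in the type \<open>'n\<close>, basis vectors are numbered
    from 1 to \<open>n\<close>; \<open>b\<close> translates between the two.\<close>
  obtain b where "bij_betw b (UNIV :: 'n set) {1..n}"
    using finite_same_card_bij[of "UNIV :: 'n set" "{1..n}"] n by auto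
  then have b: "(\<Sum>i\<in>UNIV. f (b i)) = (\<Sum>i=1..n. f i)" for f :: "nat \<Rightarrow> real"
    by (rule sum.reindex_bij_betw)
  define A where "A = (\<lambda>\<alpha> i j. a \<alpha> (b i) (b j))"
  have A: "A \<alpha> i j = A \<alpha> j i" for \<alpha> i j
    using a by (simp add: A_def)
  define B :: "nat \<Rightarrow> real^'n^'n" where "B = (\<lambda>\<alpha>. \<chi> i j. A \<alpha> i j - (if i = j then t \<alpha> else 0))"
  have n0: "real n \<noteq> 0"
    using n by auto
  have tA: "(\<Sum>i\<in>UNIV. A \<alpha> i i) = n * t \<alpha>" for \<alpha>
    using b[of "\<lambda>i. a \<alpha> i i"] n0 by (simp add: A_def t_def)
  have "transpose (B \<alpha>) = B \<alpha>" "trace (B \<alpha>) = 0" for \<alpha>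
    using A[of \<alpha>] tA[of \<alpha>] n
    by (simp_all add: B_def transpose_def vec_eq_iff trace_def sum_subtractf)
  then have *: "(\<Sum>\<alpha>=1..m. \<Sum>\<beta>=1..m. mat_normsq (commutator (B \<alpha>) (B \<beta>)))
      \<le> (\<Sum>\<alpha>=1..m. mat_normsq (B \<alpha>))\<^sup>2"
    using matrix_ineq by blast
  have "mat_normsq (B \<alpha>) = (\<Sum>i=1..n. \<Sum>j=1..n. (a \<alpha> i j)\<^sup>2) - n * (t \<alpha>)\<^sup>2" for \<alpha>
  proof -
    have "(B \<alpha> $ i $ j)\<^sup>2 = (A \<alpha> i j)\<^sup>2 + (if i = j then (t \<alpha>)\<^sup>2 - 2 * t \<alpha> * A \<alpha> i i else 0)" for i j
      by (simp add: B_def power2_diff)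
    then have "mat_normsq (B \<alpha>) =
        (\<Sum>i\<in>UNIV. \<Sum>j\<in>UNIV. (A \<alpha> i j)\<^sup>2) + (\<Sum>i\<in>UNIV. (t \<alpha>)\<^sup>2 - 2 * t \<alpha> * A \<alpha> i i)"
      by (simp add: mat_normsq_eq sum.distrib)
    also have "(\<Sum>i\<in>UNIV. (t \<alpha>)\<^sup>2 - 2 * t \<alpha> * A \<alpha> i i) = - n * (t \<alpha>)\<^sup>2"
      using n by (simp add: sum_subtractf sum_distrib_left[symmetric] tA power2_eq_square)
    also have "(\<Sum>i\<in>UNIV. \<Sum>j\<in>UNIV. (A \<alpha> i j)\<^sup>2) = (\<Sum>i=1..n. \<Sum>j=1..n. (a \<alpha> i j)\<^sup>2)"
      by (simp only: A_def b[of "\<lambda>i. (a \<alpha> k i)\<^sup>2" for k] b[of "\<lambda>i. \<Sum>j=1..n. (a \<alpha> i j)\<^sup>2"])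
    finally show ?thesis
      by simp
  qed
  moreover have "mat_normsq (commutator (B \<alpha>) (B \<beta>)) = (\<Sum>i=1..n. \<Sum>j=1..n.
      (\<Sum>k=1..n. a \<beta> i k * a \<alpha> j k - a \<alpha> i k * a \<beta> j k)\<^sup>2)" for \<alpha> \<beta>
  proof -
    \<comment> \<open>All terms containing \<open>t\<close> are symmetric in \<open>\<alpha>\<close>
      and \<open>\<beta>\<close> and therefore drop out of the commutator.\<close>
    have prod: "(B \<alpha> ** B \<beta>) $ i $ j = (\<Sum>k\<in>UNIV. A \<alpha> i k * A \<beta> j k)
        - t \<beta> * A \<alpha> i j - t \<alpha> * A \<beta> i j + (if i = j then t \<alpha> * t \<beta> else 0)" for \<alpha> \<beta> i j
    proof -
      have "(A \<alpha> i k - (if i = k then t \<alpha> else 0)) * (A \<beta> k j - (if k = j then t \<beta> else 0))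
        = A \<alpha> i k * A \<beta> j k - (if k = j then t \<beta> * A \<alpha> i j else 0)
          - (if k = i then t \<alpha> * A \<beta> i j else 0)
          + (if k = i then if i = j then t \<alpha> * t \<beta> else 0 else 0)" for k
        using A[of \<beta> k j] A[of \<beta> i j] by (simp add: algebra_simps)
      then show ?thesis
        by (simp add: matrix_matrix_mult_def B_def sum.distrib sum_subtractf)
    qed
    \<comment> \<open>The square hides a change of sign: the difference is written in the order in
      which the Ricci equation produces it.\<close>
    have "(commutator (B \<alpha>) (B \<beta>) $ i $ j)\<^sup>2
        = (\<Sum>k\<in>UNIV. A \<beta> i k * A \<alpha> j k - A \<alpha> i k * A \<beta> j k)\<^sup>2" for i j
      by (simp add: commutator_def prod sum_subtractf power2_commute)
    also have "\<dots> i j = (\<Sum>k=1..n. a \<beta> (b i) k * a \<alpha> (b j) k - a \<alpha> (b i) k * a \<beta> (b j) k)\<^sup>2" for i j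
      using b[of "\<lambda>k. a \<beta> (b i) k * a \<alpha> (b j) k - a \<alpha> (b i) k * a \<beta> (b j) k"] by (simp add: A_def)
    finally have sq: "(commutator (B \<alpha>) (B \<beta>) $ i $ j)\<^sup>2
        = (\<Sum>k=1..n. a \<beta> (b i) k * a \<alpha> (b j) k - a \<alpha> (b i) k * a \<beta> (b j) k)\<^sup>2" for i j .
    show ?thesis
      by (simp only: mat_normsq_eq sq
          b[of "\<lambda>j. (\<Sum>k=1..n. a \<beta> i k * a \<alpha> j k - a \<alpha> i k * a \<beta> j k)\<^sup>2" for i]
          b[of "\<lambda>i. \<Sum>j=1..n. (\<Sum>k=1..n. a \<beta> i k * a \<alpha> j k - a \<alpha> i k * a \<beta> j k)\<^sup>2"])
  qed
  ultimately show ?thesis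
    using * by simp
qed

text \<open>The result without geometry. Multiplied by \<open>r\<close>, it combines
  \<open>2 * sqrt P \<le> N\<close> with the formula for \<open>2 * Q\<close>, where
  \<open>N\<close> is the sum of the squared norms of the traceless parts.\<close>

lemma second_fundamental_form_inequality:
  fixes a :: "nat \<Rightarrow> nat \<Rightarrow> nat \<Rightarrow> real" and c :: real
  assumes n: "n \<ge> 2" "CARD('n::finite) = n"
    and matrix_ineq: "\<forall>B :: nat \<Rightarrow> real^'n^'n.
         (\<forall>\<alpha>\<in>{1..m}. transpose (B \<alpha>) = B \<alpha> \<and> trace (B \<alpha>) = 0) \<longrightarrow>
         (\<Sum>\<alpha>=1..m. \<Sum>\<beta>=1..m. mat_normsq (commutator (B \<alpha>) (B \<beta>)))
           \<le> (\<Sum>\<alpha>=1..m. mat_normsq (B \<alpha>))\<^sup>2"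
    and a: "\<And>\<alpha> i j. a \<alpha> i j = a \<alpha> j i"
  shows "2 / (real n * (real n - 1)) *
      (\<Sum>j=1..n. \<Sum>i=1..<j. c + (\<Sum>\<alpha>=1..m. a \<alpha> i i * a \<alpha> j j - (a \<alpha> i j)\<^sup>2))
    \<le> (\<Sum>\<alpha>=1..m. ((\<Sum>i=1..n. a \<alpha> i i) / n)\<^sup>2)
      - 2 / (real n * (real n - 1)) * sqrt (\<Sum>j=1..n. \<Sum>i=1..<j. \<Sum>\<beta>=1..m. \<Sum>\<alpha>=1..<\<beta>.
          (\<Sum>k=1..n. a \<beta> i k * a \<alpha> j k - a \<alpha> i k * a \<beta> j k)\<^sup>2) + c"
proof -
  define t where "t = (\<lambda>\<alpha>. (\<Sum>i=1..n. a \<alpha> i i) / n)"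
  define K where "K = (\<lambda>\<alpha> \<beta> i j. (\<Sum>k=1..n. a \<beta> i k * a \<alpha> j k - a \<alpha> i k * a \<beta> j k)\<^sup>2)"
  define N where "N = (\<Sum>\<alpha>=1..m. (\<Sum>i=1..n. \<Sum>j=1..n. (a \<alpha> i j)\<^sup>2) - n * (t \<alpha>)\<^sup>2)"
  define P where "P = (\<Sum>j=1..n. \<Sum>i=1..<j. \<Sum>\<beta>=1..m. \<Sum>\<alpha>=1..<\<beta>. K \<alpha> \<beta> i j)"
  define Q where "Q = (\<Sum>j=1..n. \<Sum>i=1..<j. c + (\<Sum>\<alpha>=1..m. a \<alpha> i i * a \<alpha> j j - (a \<alpha> i j)\<^sup>2))"
  define r where "r = real n * (real n - 1)"
  have r: "r > 0"
    using n by (simp add: r_def)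
  have K_swap: "K \<alpha> \<beta> i j = K \<beta> \<alpha> i j" "K \<alpha> \<beta> i j = K \<alpha> \<beta> j i" "K \<alpha> \<alpha> i j = 0" "K \<alpha> \<beta> i i = 0"
    for \<alpha> \<beta> i j
  proof -
    show "K \<alpha> \<beta> i j = K \<beta> \<alpha> i j"
      unfolding K_def by (simp add: sum_subtractf power2_commute)
    show "K \<alpha> \<beta> i j = K \<alpha> \<beta> j i"
      unfolding K_def by (simp add: sum_subtractf power2_commute mult.commute)
  qed (simp_all add: K_def mult.commute)
  \<comment> \<open>The matrix inequality counts both pairs of indices in both orders,
    \<open>P\<close> each of them once, and the diagonal terms vanish; hence the factor 4.\<close>
  have four: "(\<Sum>\<alpha>=1..m. \<Sum>\<beta>=1..m. \<Sum>i=1..n. \<Sum>j=1..n. K \<alpha> \<beta> i j) = 4 * P"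
  proof -
    have "(\<Sum>i=1..n. \<Sum>j=1..n. K \<alpha> \<beta> i j) = 2 * (\<Sum>j=1..n. \<Sum>i=1..<j. K \<alpha> \<beta> i j)" for \<alpha> \<beta>
      using sum_symmetric_eq[of "K \<alpha> \<beta>" n] K_swap(2,4) by simp
    moreover have "(\<Sum>\<alpha>=1..m. \<Sum>\<beta>=1..m. 2 * (\<Sum>j=1..n. \<Sum>i=1..<j. K \<alpha> \<beta> i j))
      = 2 * (\<Sum>\<beta>=1..m. \<Sum>\<alpha>=1..<\<beta>. 2 * (\<Sum>j=1..n. \<Sum>i=1..<j. K \<alpha> \<beta> i j))"
      using sum_symmetric_eq[of "\<lambda>\<alpha> \<beta>. 2 * (\<Sum>j=1..n. \<Sum>i=1..<j. K \<alpha> \<beta> i j)" m] K_swap(1,3) by simp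
    moreover have "(\<Sum>\<beta>=1..m. \<Sum>\<alpha>=1..<\<beta>. \<Sum>j=1..n. \<Sum>i=1..<j. K \<alpha> \<beta> i j) = P"
      unfolding P_def sum_swap_inner[where C = "{1..m}"]
      by (simp only: sum_swap_inner[where A = "{1..n}" and B = "\<lambda>j. {1..<j}"])
    ultimately show ?thesis
      by (simp add: sum_distrib_left[symmetric])
  qed
  have sq: "4 * P \<le> N\<^sup>2"
    using traceless_matrix_inequality[OF n(2) matrix_ineq a]
    by (simp only: four[symmetric] K_def N_def t_def)
  have n0: "real n \<noteq> 0"
    using n by simp
  \<comment> \<open>The sign of \<open>N\<close> is what allows the square root to be taken in
    \<open>4 * P \<le> N\<^sup>2\<close>; it comes from Cauchy-Schwarz for the diagonal
    entries.\<close>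
  have N0: "0 \<le> N"
    unfolding N_def
  proof (rule sum_nonneg)
    fix \<alpha>
    have "(\<Sum>i=1..n. a \<alpha> i i)\<^sup>2 \<le> (\<Sum>i=1..n. (a \<alpha> i i)\<^sup>2) * n"
      using sum_squared_le_sum_of_squares[of "\<lambda>i. a \<alpha> i i" "{1..n}"] by (simp add: mult.commute)
    then have "n * (t \<alpha>)\<^sup>2 \<le> (\<Sum>i=1..n. (a \<alpha> i i)\<^sup>2)"
      using n by (simp add: t_def field_simps power2_eq_square)
    also have "\<dots> \<le> (\<Sum>i=1..n. \<Sum>j=1..n. (a \<alpha> i j)\<^sup>2)"
      by (intro sum_mono member_le_sum) auto
    finally show "0 \<le> (\<Sum>i=1..n. \<Sum>j=1..n. (a \<alpha> i j)\<^sup>2) - n * (t \<alpha>)\<^sup>2"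
      by simp
  qed
  have "sqrt P \<le> N / 2"
    using sq N0 by (intro real_le_lsqrt) (simp_all add: power_divide)
  moreover have "2 * Q = r * c + r * (\<Sum>\<alpha>=1..m. (t \<alpha>)\<^sup>2) - N"
  proof -
    let ?f = "\<lambda>i j. c + (\<Sum>\<alpha>=1..m. a \<alpha> i i * a \<alpha> j j - (a \<alpha> i j)\<^sup>2)"
    have sym: "?f i j = ?f j i" for i j
      by (simp add: mult.commute a[of _ i j])
    \<comment> \<open>On the diagonal the products cancel and \<open>?f i i = c\<close>, which
      accounts for the subtracted \<open>n * c\<close>.\<close>
    have "2 * Q = (\<Sum>i=1..n. \<Sum>j=1..n. ?f i j) - n * c"
      using sum_symmetric_eq[of ?f n, OF sym] by (simp add: Q_def power2_eq_square)
    also have "(\<Sum>i=1..n. \<Sum>j=1..n. ?f i j) = n * n * c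
        + (\<Sum>\<alpha>=1..m. \<Sum>i=1..n. \<Sum>j=1..n. a \<alpha> i i * a \<alpha> j j - (a \<alpha> i j)\<^sup>2)"
      unfolding sum.distrib sum_swap_inner[where C = "{1..m}"] by simp
    also have "(\<Sum>\<alpha>=1..m. \<Sum>i=1..n. \<Sum>j=1..n. a \<alpha> i i * a \<alpha> j j - (a \<alpha> i j)\<^sup>2)
        = r * (\<Sum>\<alpha>=1..m. (t \<alpha>)\<^sup>2) - N"
    proof -
      have "(\<Sum>i=1..n. a \<alpha> i i) = n * t \<alpha>" for \<alpha>
        using n0 by (simp add: t_def)
      then have "(\<Sum>i=1..n. \<Sum>j=1..n. a \<alpha> i i * a \<alpha> j j) = n * t \<alpha> * (n * t \<alpha>)" for \<alpha>
        by (simp add: sum_product[symmetric])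
      then show ?thesis
        by (simp add: N_def r_def sum_subtractf sum_distrib_left algebra_simps power2_eq_square)
    qed
    finally show ?thesis
      by (simp add: r_def algebra_simps)
  qed
  ultimately have "2 * Q \<le> r * (\<Sum>\<alpha>=1..m. (t \<alpha>)\<^sup>2) - 2 * sqrt P + r * c"
    by linarith
  then have "2 / r * Q \<le> (\<Sum>\<alpha>=1..m. (t \<alpha>)\<^sup>2) - 2 / r * sqrt P + c"
    using r by (simp add: field_simps)
  then show ?thesis
    by (simp only: Q_def P_def K_def t_def r_def)
qed

theorem (in isometric_coord_map) pointwise_inequality:
  fixes e :: "nat \<Rightarrow> real^'n" and u :: "nat \<Rightarrow> real^'k" and c :: real
  assumes x: "x \<in> U"
    and n: "n \<ge> 2" "CARD('n) = n"
    and matrix_ineq: "\<forall>B :: nat \<Rightarrow> real^'n^'n.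
         (\<forall>\<alpha>\<in>{1..m}. transpose (B \<alpha>) = B \<alpha> \<and> trace (B \<alpha>) = 0) \<longrightarrow>
         (\<Sum>\<alpha>=1..m. \<Sum>\<beta>=1..m. mat_normsq (commutator (B \<alpha>) (B \<beta>)))
           \<le> (\<Sum>\<alpha>=1..m. mat_normsq (B \<alpha>))\<^sup>2"
    and sectional: "\<And>v w. G x v v = 1 \<Longrightarrow> G x w w = 1 \<Longrightarrow> G x v w = 0 \<Longrightarrow>
      G x (curvature g' (F x) v w w) v = c"
    and e: "orthonormal_basis (g x) UNIV n e"
    and u: "orthonormal_basis (G x) (normal_space_at g' F x) m u"
  defines "H \<equiv> mean_curvature_vector g' F x n e"
  shows "normalized_scalar_curvature g x n e
    \<le> G x H H - normalized_normal_scalar_curvature g' F x n m e u + c"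
proof -
  define a where "a = (\<lambda>\<alpha> i j. G x (II x (e i) (e j)) (u \<alpha>))"
  have uN: "u \<alpha> \<in> normal_space_at g' F x" if "\<alpha> \<in> {1..m}" for \<alpha>
    using u that unfolding orthonormal_basis_def by (metis imageI span_base)
  have lin: "linear (\<lambda>\<xi>. G x \<xi> \<eta>)" for \<eta>
    using target.bilinear[OF target.in_V[OF x]] by (simp add: bilinear_def)
  \<comment> \<open>Parseval in the normal basis applies to vectors of its span only; being that
    span, the normal space is closed under sums and multiples.\<close>
  have H_normal: "H \<in> normal_space_at g' F x"
  proof -
    have "subspace (normal_space_at g' F x)"
      using u unfolding orthonormal_basis_def by (metis subspace_span)
    then show ?thesis
      unfolding H_def mean_curvature_vector_def
      by (intro subspace_scale subspace_sum II_in_normal_space x)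
  qed
  have "G x H (u \<alpha>) = (\<Sum>i=1..n. a \<alpha> i i) / n" for \<alpha>
    by (simp add: H_def mean_curvature_vector_def linear_scale[OF lin] linear_sum[OF lin] a_def)
  then have HH: "G x H H = (\<Sum>\<alpha>=1..m. ((\<Sum>i=1..n. a \<alpha> i i) / n)\<^sup>2)"
    using orthonormal_basis_parseval[OF target.bilinear[OF target.in_V[OF x]]
        target.sym[OF target.in_V[OF x]] u H_normal, of H]
    by (simp add: power2_eq_square)
  have gauss: "g x (curvature g x (e i) (e j) (e j)) (e i)
      = c + (\<Sum>\<alpha>=1..m. a \<alpha> i i * a \<alpha> j j - (a \<alpha> i j)\<^sup>2)" if "j \<in> {1..n}" "i \<in> {1..<j}" for i j
    unfolding a_def by (rule gauss_equation_space_form[OF x sectional e u]) (use that in auto)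
  have ricci: "G x (normal_curvature g' F x (e i) (e j) (u \<alpha>)) (u \<beta>)
      = (\<Sum>k=1..n. a \<beta> i k * a \<alpha> j k - a \<alpha> i k * a \<beta> j k)"
    if "\<beta> \<in> {1..m}" "\<alpha> \<in> {1..<\<beta>}" for i j \<alpha> \<beta>
    unfolding a_def by (rule ricci_equation_space_form[OF x sectional e]) (use that in \<open>auto intro!: uN\<close>)
  have "normalized_scalar_curvature g x n e = 2 / (real n * (real n - 1)) *
      (\<Sum>j=1..n. \<Sum>i=1..<j. c + (\<Sum>\<alpha>=1..m. a \<alpha> i i * a \<alpha> j j - (a \<alpha> i j)\<^sup>2))"
    unfolding normalized_scalar_curvature_def by (simp only: gauss cong: sum.cong)
  moreover have "normalized_normal_scalar_curvature g' F x n m e u =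
      2 / (real n * (real n - 1)) * sqrt (\<Sum>j=1..n. \<Sum>i=1..<j. \<Sum>\<beta>=1..m. \<Sum>\<alpha>=1..<\<beta>.
          (\<Sum>k=1..n. a \<beta> i k * a \<alpha> j k - a \<alpha> i k * a \<beta> j k)\<^sup>2)"
    unfolding normalized_normal_scalar_curvature_def by (simp only: ricci cong: sum.cong)
  moreover have "a \<alpha> i j = a \<alpha> j i" for \<alpha> i j
    unfolding a_def using II_sym[OF x, of "e i" "e j"] by simp
  ultimately show ?thesis
    using second_fundamental_form_inequality[OF n matrix_ineq, of a c] HH by simp
qed

section \<open>From charts of manifolds to coordinate domains\<close>

lemma smooth_metric_chart:
  fixes g :: "('p, real^'n) chart \<Rightarrow> (real^'n) coord_metric"
  assumes "riemannian_manifold M A g" "\<phi> \<in> A" "open S" "S \<subseteq> snd \<phi> ` fst \<phi>"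
  shows "smooth_metric (g \<phi>) S"
proof
  show "smooth_on S (\<lambda>x. g \<phi> x v w)" for v w
    using assms smooth_on_subset unfolding riemannian_manifold_def by metis
qed (use assms in \<open>auto simp: riemannian_manifold_def subset_iff\<close>)

lemma open_chart_image:
  assumes "smooth_manifold M A" "\<phi> \<in> A"
  shows "open (snd \<phi> ` fst \<phi>)"
  using assms by (simp add: smooth_manifold_def)

lemma inj_on_chart:
  assumes "smooth_manifold M A" "\<phi> \<in> A"
  shows "inj_on (snd \<phi>) (fst \<phi>)"
proof -
  have "homeomorphic_map (subtopology M (fst \<phi>)) (top_of_set (snd \<phi> ` fst \<phi>)) (snd \<phi>)" "openin M (fst \<phi>)"
    using assms by (simp_all add: smooth_manifold_def)
  then show ?thesis
    using homeomorphic_imp_injective_map openin_subset topspace_subtopology_subset by metis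
qed

lemma chart_inv_chart:
  assumes "smooth_manifold M A" "\<phi> \<in> A" "p \<in> fst \<phi>"
  shows "chart_inv \<phi> (snd \<phi> p) = p"
  unfolding chart_inv_def by (rule inv_into_f_f[OF inj_on_chart[OF assms(1,2)] assms(3)])

text \<open>The coordinate domain of a local representation must be open for the derivative rules.
  The chart homeomorphism gives openness relative to the chart image, which is itself open.\<close>

lemma open_chart_preimage:
  assumes "smooth_manifold M A" "smooth_manifold N A'" "\<phi> \<in> A" "\<psi> \<in> A'" "continuous_map M N f"
  shows "open (snd \<phi> ` (fst \<phi> \<inter> f -` fst \<psi>))"
proof -
  have \<phi>: "openin M (fst \<phi>)" "open (snd \<phi> ` fst \<phi>)"
      "homeomorphic_map (subtopology M (fst \<phi>)) (top_of_set (snd \<phi> ` fst \<phi>)) (snd \<phi>)"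
    and \<psi>: "openin N (fst \<psi>)"
    using assms by (simp_all add: smooth_manifold_def)
  have "fst \<phi> \<inter> f -` fst \<psi> = {x \<in> topspace M. f x \<in> fst \<psi>} \<inter> fst \<phi>"
    using openin_subset[OF \<phi>(1)] by auto
  then have "openin (subtopology M (fst \<phi>)) (fst \<phi> \<inter> f -` fst \<psi>)"
    using openin_continuous_map_preimage[OF assms(5) \<psi>] by (auto simp: openin_subtopology)
  then have "openin (top_of_set (snd \<phi> ` fst \<phi>)) (snd \<phi> ` (fst \<phi> \<inter> f -` fst \<psi>))"
    using homeomorphic_imp_open_map[OF \<phi>(3)] by (simp add: open_map_def)
  then show ?thesis
    using \<phi>(2) openin_open_trans by blast
qed

theorem theorem3p1:
  fixes n m :: nat and c :: real
    and M :: "'p topology" and A :: "('p, real^'n) chart set"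
    and g :: "('p, real^'n) chart \<Rightarrow> (real^'n) coord_metric"
    and N :: "'q topology" and A' :: "('q, real^'k) chart set"
    and g' :: "('q, real^'k) chart \<Rightarrow> (real^'k) coord_metric"
    and f :: "'p \<Rightarrow> 'q" and p :: 'p
    and \<phi> :: "('p, real^'n) chart" and \<psi> :: "('q, real^'k) chart"
    and e :: "nat \<Rightarrow> real^'n" and u :: "nat \<Rightarrow> real^'k"
  assumes n: "n \<ge> 2" "CARD('n) = n" and m: "m \<ge> 1" "CARD('k) = n + m"
    and matrix_ineq:
      "\<forall>B :: nat \<Rightarrow> real^'n^'n.
         (\<forall>\<alpha>\<in>{1..m}. transpose (B \<alpha>) = B \<alpha> \<and> trace (B \<alpha>) = 0) \<longrightarrow>
         (\<Sum>\<alpha>=1..m. \<Sum>\<beta>=1..m. mat_normsq (commutator (B \<alpha>) (B \<beta>)))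
           \<le> (\<Sum>\<alpha>=1..m. mat_normsq (B \<alpha>))\<^sup>2"
    and space_form: "real_space_form N A' g' c"
    and submanifold: "riemannian_manifold M A g" "isometric_immersion M A g N A' g' f"
    and point: "p \<in> topspace M"
    and charts: "\<phi> \<in> A" "p \<in> fst \<phi>" "\<psi> \<in> A'" "f p \<in> fst \<psi>"
    and tangent_basis: "orthonormal_basis (g \<phi> (snd \<phi> p)) UNIV n e"
    and normal_basis:
      "orthonormal_basis (g' \<psi> (snd \<psi> (f p)))
         (normal_space_at (g' \<psi>) (local_rep \<phi> \<psi> f) (snd \<phi> p)) m u"
  shows "normalized_scalar_curvature (g \<phi>) (snd \<phi> p) n e
    \<le> (let H = mean_curvature_vector (g' \<psi>) (local_rep \<phi> \<psi> f) (snd \<phi> p) n e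
        in g' \<psi> (snd \<psi> (f p)) H H)
      - normalized_normal_scalar_curvature (g' \<psi>) (local_rep \<phi> \<psi> f) (snd \<phi> p) n m e u
      + c"
proof -
  define F where "F = local_rep \<phi> \<psi> f"
  \<comment> \<open>Only here does the coordinate expression \<open>F\<close> represent the
    immersion, since \<open>snd \<psi>\<close> is meaningless off the domain of
    \<open>\<psi>\<close>.\<close>
  define U where "U = snd \<phi> ` (fst \<phi> \<inter> f -` fst \<psi>)"
  define V where "V = snd \<psi> ` fst \<psi>"
  have MA: "smooth_manifold M A"
    using submanifold(1) by (simp add: riemannian_manifold_def)
  have riemN: "riemannian_manifold N A' g'"
    using space_form by (simp add: real_space_form_def)
  then have NA: "smooth_manifold N A'"
    by (simp add: riemannian_manifold_def)
  have F: "F (snd \<phi> q) = snd \<psi> (f q)" if "q \<in> fst \<phi>" for q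
    using chart_inv_chart[OF MA charts(1) that] by (simp add: F_def local_rep_def)
  have "continuous_map M N f"
    using submanifold(2) by (simp add: isometric_immersion_def)
  then have openU: "open U"
    unfolding U_def by (rule open_chart_preimage[OF MA NA charts(1,3)])
  have imm: "smooth_on U F" "\<forall>x\<in>U. \<forall>v w. g' \<psi> (F x) (dirderiv F x v) (dirderiv F x w) = g \<phi> x v w"
    using submanifold(2) charts(1,3) unfolding isometric_immersion_def Let_def U_def F_def by blast+
  interpret source: smooth_metric "g \<phi>" U
    by (rule smooth_metric_chart[OF submanifold(1) charts(1) openU]) (auto simp: U_def)
  interpret ambient: smooth_metric "g' \<psi>" V
    by (rule smooth_metric_chart[OF riemN charts(3)]) (simp_all add: V_def open_chart_image[OF NA charts(3)])
  interpret isometric_coord_map "g' \<psi>" V F U "g \<phi>"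
    by unfold_locales (use openU imm F in \<open>auto simp: U_def V_def\<close>)
  have x: "snd \<phi> p \<in> U"
    using charts by (simp add: U_def)
  have Fx: "F (snd \<phi> p) = snd \<psi> (f p)" "snd \<psi> (f p) \<in> snd \<psi> ` fst \<psi>"
    using F charts by auto
  have sectional: "g' \<psi> (F (snd \<phi> p)) (curvature (g' \<psi>) (F (snd \<phi> p)) v w w) v = c"
    if "g' \<psi> (F (snd \<phi> p)) v v = 1" "g' \<psi> (F (snd \<phi> p)) w w = 1" "g' \<psi> (F (snd \<phi> p)) v w = 0" for v w
    using space_form that Fx charts(3) unfolding real_space_form_def by metis
  show ?thesis
    using pointwise_inequality[OF x n matrix_ineq sectional tangent_basis] normal_basis
    by (simp add: Fx(1) Let_def flip: F_def)
qed

end
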